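(* Let $n$ be a positive odd integer, and for $k\geqslant 0$ let $$c_q(k)=(-1)^k[3k+1]\frac{(aq,q/a,q;q^2)_k}{(aq,q/a,q;q)_k}.$$ Then $$\sum_{k=0}^{n-1}\sum_{j=0}^{k}c_q(j)c_q(k-j)\equiv q^{(n-1)^2/2}[n]^2\pmod{[n](1-aq^n)(a-q^n)}.$$
   Context: Here $q$ and $a$ are indeterminates. The $q$-shifted factorial is $(x;q)_0=1$ and $(x;q)_m=(1-x)(1-xq)\cdots(1-xq^{m-1})$ for $m\geqslant1$, with $(x_1,\ldots,x_r;q)_m=(x_1;q)_m\cdots(x_r;q)_m$; the $q$-integer is $[m]=1+q+\cdots+q^{m-1}$. For rational functions $A,B$ in $q,a$ and a polynomial $P$ in $q,a$, $A\equiv B\pmod{P}$ means that $A-B=P\cdot U/V$ for polynomials $U,V$ with $V$ coprime to $P$. *)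

theory Defs
  imports "HOL-Computational_Algebra.Polynomial_Factorial"
begin

definition qpoch :: "'a::comm_ring_1 \<Rightarrow> 'a \<Rightarrow> nat \<Rightarrow> 'a" where
  "qpoch x q m = (\<Prod>i<m. 1 - x * q ^ i)"

definition qpochs :: "'a::comm_ring_1 list \<Rightarrow> 'a \<Rightarrow> nat \<Rightarrow> 'a" where
  "qpochs xs q m = (\<Prod>x\<leftarrow>xs. qpoch x q m)"

definition qint :: "'a::comm_ring_1 \<Rightarrow> nat \<Rightarrow> 'a" where
  "qint q m = (\<Sum>i<m. q ^ i)"

text \<open>
  The polynomial ring in the indeterminates \<open>q\<close> and \<open>a\<close> over the rationals is taken as
  \<open>(rat[q])[a]\<close>; its fraction field is the field of rational functions in \<open>q\<close> and \<open>a\<close>.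
\<close>

type_synonym qa_poly = "rat poly poly"
type_synonym qa_ratfun = "qa_poly fract"

definition q_poly :: qa_poly where
  "q_poly = [:[:0, 1:]:]"

definition a_poly :: qa_poly where
  "a_poly = [:0, 1:]"

definition q_rat :: qa_ratfun where
  "q_rat = to_fract q_poly"

definition a_rat :: qa_ratfun where
  "a_rat = to_fract a_poly"

definition ratfun_cong :: "qa_ratfun \<Rightarrow> qa_ratfun \<Rightarrow> qa_poly \<Rightarrow> bool" where
  "ratfun_cong A B P \<longleftrightarrow>
     (\<exists>U V :: qa_poly. V \<noteq> 0 \<and> coprime V P \<and> A - B = to_fract P * (to_fract U / to_fract V))"

definition c_q :: "nat \<Rightarrow> qa_ratfun" where
  "c_q k = (- 1) ^ k * qint q_rat (3 * k + 1)
     * (qpochs [a_rat * q_rat, q_rat / a_rat, q_rat] (q_rat ^ 2) k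
        / qpochs [a_rat * q_rat, q_rat / a_rat, q_rat] q_rat k)"

end

theory Submission
  imports Defs "HOL-Computational_Algebra.Field_as_Ring"
begin

text \<open>
  The terms satisfy a contiguity relation in the parameter:
  \<open>(a - 1) c(k; a q\<^sup>2) + a (a q\<^sup>2 - 1) c(k; a)\<close> telescopes in \<open>k\<close>. This single relation, found by
  Gosper summation, handles all three factors of the modulus. At \<open>a = q^(-n)\<close> with \<open>n = 2 m + 1\<close> the sum
  over \<open>k\<close> terminates and the boundary term vanishes, so induction on \<open>m\<close> gives the value
  \<open>(-1)^m q^(m\<^sup>2) [n]\<close>, whose square is the right-hand side; \<open>a = q^n\<close> follows from the symmetry
  \<open>a \<mapsto> 1/a\<close>. At a primitive \<open>d\<close>-th root of unity \<open>q = z\<close> with \<open>d\<close> odd, the boundary term vanishes as well, for every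
  \<open>a\<close>, and applying the relation \<open>d\<close> times to the truncated sum \<open>T\<close> gives
  \<open>T(a) = - a^d T(a)\<close>, hence \<open>T = 0\<close>. Periodicity of the terms modulo \<open>d\<close> then makes the double sum vanish.
  The numerator of the difference, a polynomial in \<open>q\<close> and \<open>a\<close>, therefore vanishes at enough points to be divisible by
  each of the three pairwise coprime factors.
\<close>

subsection \<open>Central Gaussian binomial coefficients\<close>

text \<open>Pascal's recurrence makes the coefficient meaningful in every commutative ring, in
  particular at roots of unity, where the quotient of q-factorials can degenerate to 0/0.\<close>

fun gbinom :: "'a::comm_ring_1 \<Rightarrow> nat \<Rightarrow> nat \<Rightarrow> 'a" where
  "gbinom q n 0 = 1"
| "gbinom q 0 (Suc k) = 0"
| "gbinom q (Suc n) (Suc k) = gbinom q n k + q ^ Suc k * gbinom q n (Suc k)"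

lemma gbinom_eq_0: "n < k \<Longrightarrow> gbinom q n k = 0"
  by (induction q n k rule: gbinom.induct) auto

text \<open>Pascal's rule turns the induction hypothesis into the absorption identity
  \<open>step\<close>; for \<open>k = Suc j\<close> both sides then equal
  \<open>(1 - q ^ Suc n) * gbinom q n (Suc j)\<close>.\<close>

lemma gbinom_Suc_right:
  "k \<le> n \<Longrightarrow> (1 - q ^ Suc k) * gbinom q n (Suc k) = (1 - q ^ (n - k)) * gbinom q n k"
proof (induction n arbitrary: k)
  case 0
  then show ?case by simp
next
  case (Suc n)
  have step: "(1 - q ^ Suc j) * gbinom q (Suc n) (Suc j) = (1 - q ^ Suc n) * gbinom q n j"
    if "j \<le> n" for j
  proof -
    have "q ^ Suc j * q ^ (n - j) = q ^ Suc n"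
      using that by (simp flip: power_add power_Suc)
    then show ?thesis
      using arg_cong[OF Suc.IH[OF that], of "\<lambda>x. q ^ Suc j * x"]
      by (simp add: algebra_simps)
  qed
  show ?case
  proof (cases k)
    case 0
    then show ?thesis using step[of 0] by simp
  next
    case (Suc j)
    then have jn: "j \<le> n" using Suc.prems by simp
    have "(1 - q ^ (n - j)) * gbinom q (Suc n) (Suc j) = (1 - q ^ Suc n) * gbinom q n (Suc j)"
    proof -
      have "q ^ Suc j * q ^ (n - j) = q ^ Suc n"
        using jn by (simp flip: power_add power_Suc)
      then have "q ^ Suc j * q ^ (n - j) * gbinom q n (Suc j) = q ^ Suc n * gbinom q n (Suc j)"
        by simp
      then show ?thesis
        using Suc.IH[OF jn] by (simp add: algebra_simps)
    qed
    moreover have "(1 - q ^ Suc (Suc j)) * gbinom q (Suc n) (Suc (Suc j))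
        = (1 - q ^ Suc n) * gbinom q n (Suc j)"
    proof (cases "Suc j \<le> n")
      case False
      then show ?thesis by (simp add: gbinom_eq_0)
    qed (rule step)
    ultimately show ?thesis using Suc by simp
  qed
qed

lemma gbinom_Suc_Suc:
  assumes "k \<le> n"
  shows "(1 - q ^ Suc k) * gbinom q (Suc n) (Suc k) = (1 - q ^ Suc n) * gbinom q n k"
proof -
  have "q ^ Suc k * q ^ (n - k) = q ^ Suc n"
    using assms by (simp flip: power_add power_Suc)
  then show ?thesis
    using arg_cong[OF gbinom_Suc_right[OF assms, of q], of "\<lambda>x. q ^ Suc k * x"]
    by (simp add: algebra_simps)
qed

lemma gbinom_Suc_left:
  assumes "k \<le> n"
  shows "(1 - q ^ (Suc n - k)) * gbinom q (Suc n) k = (1 - q ^ Suc n) * gbinom q n k"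
  using gbinom_Suc_right[of k "Suc n" q] gbinom_Suc_Suc[OF assms, of q] assms by simp

definition central_gbinom :: "'a::comm_ring_1 \<Rightarrow> nat \<Rightarrow> 'a" where
  "central_gbinom q k = gbinom q (2 * k) k"

lemma central_gbinom_0 [simp]: "central_gbinom q 0 = 1"
  by (simp add: central_gbinom_def)

text \<open>The second factor \<open>1 - q ^ Suc k\<close> is absorbed by
  \<open>gbinom_Suc_left\<close> rather than cancelled, so the recurrence also holds where it
  vanishes.\<close>

lemma central_gbinom_Suc:
  "(1 - q ^ Suc k) * central_gbinom q (Suc k)
     = (1 + q ^ Suc k) * (1 - q ^ (2 * k + 1)) * central_gbinom q k"
proof -
  have "(1 - q ^ Suc k) * central_gbinom q (Suc k)
      = (1 - q ^ (2 * Suc k)) * gbinom q (2 * k + 1) k"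
    using gbinom_Suc_Suc[of k "2 * k + 1" q] by (simp add: central_gbinom_def)
  also have "1 - q ^ (2 * Suc k) = (1 + q ^ Suc k) * (1 - q ^ Suc k)"
    unfolding mult_2 power_add by (simp add: algebra_simps)
  also have "(1 + q ^ Suc k) * (1 - q ^ Suc k) * gbinom q (2 * k + 1) k
      = (1 + q ^ Suc k) * ((1 - q ^ (2 * k + 1)) * gbinom q (2 * k) k)"
    using gbinom_Suc_left[of k "2 * k" q] by (simp add: mult.assoc)
  finally show ?thesis by (simp add: central_gbinom_def mult.assoc)
qed

lemma central_gbinom_qpoch:
  "central_gbinom q k * (\<Prod>i<k. 1 - q ^ Suc i)
     = (\<Prod>i<k. 1 - q ^ (2 * i + 1)) * (\<Prod>i<k. 1 + q ^ Suc i)"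
proof (induction k)
  case (Suc k)
  then show ?case using central_gbinom_Suc[of q k]
    by (simp add: mult_ac) (metis (no_types, lifting) mult.assoc mult.left_commute)
qed simp

lemma qint_mult_one_minus: "(1 - q) * qint q m = 1 - q ^ m"
  unfolding qint_def by (simp add: one_diff_power_eq)

subsection \<open>The terms and their telescoping relation\<close>

text \<open>
  The quotient \<open>(q;q\<^sup>2)\<^sub>k / (q;q)\<^sub>k\<close> is rewritten as a central Gaussian binomial over \<open>(-q;q)\<^sub>k\<close>:
  unlike \<open>(q;q)\<^sub>k\<close>, the new denominator is coprime to \<open>[n]\<close> for odd \<open>n\<close> and does not vanish at
  roots of unity of odd order.
\<close>

definition c_num :: "'a::comm_ring_1 \<Rightarrow> 'a \<Rightarrow> nat \<Rightarrow> 'a" where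
  "c_num q a k = (- 1) ^ k * qint q (3 * k + 1) * central_gbinom q k
     * (\<Prod>i<k. (1 - a * q ^ (2 * i + 1)) * (a - q ^ (2 * i + 1)))"

text \<open>The factor \<open>a - q ^ Suc i\<close> comes from \<open>q / a\<close> after
  multiplication by \<open>a\<close>; these powers of \<open>a\<close> cancel against those in
  \<open>c_num\<close>. A name for one factor lets \<open>defect\<close> fill up a denominator by
  its missing tail.\<close>

definition c_den_fac :: "'a::comm_ring_1 \<Rightarrow> 'a \<Rightarrow> nat \<Rightarrow> 'a" where
  "c_den_fac q a i = (1 - a * q ^ Suc i) * (a - q ^ Suc i) * (1 + q ^ Suc i)"

definition c_den :: "'a::comm_ring_1 \<Rightarrow> 'a \<Rightarrow> nat \<Rightarrow> 'a" where
  "c_den q a k = (\<Prod>i<k. c_den_fac q a i)"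

text \<open>The term is split so that the shift of \<open>a\<close> to \<open>a * q\<^sup>2\<close>
  acts on \<open>param_part\<close> alone.\<close>

definition const_part :: "'a::field \<Rightarrow> nat \<Rightarrow> 'a" where
  "const_part q k = (- 1) ^ k * central_gbinom q k / (\<Prod>i<k. 1 + q ^ Suc i)"

definition param_part :: "'a::field \<Rightarrow> 'a \<Rightarrow> nat \<Rightarrow> 'a" where
  "param_part q a k = (\<Prod>i<k. (1 - a * q ^ (2 * i + 1)) * (a - q ^ (2 * i + 1))
     / ((1 - a * q ^ Suc i) * (a - q ^ Suc i)))"

definition c_val :: "'a::field \<Rightarrow> 'a \<Rightarrow> nat \<Rightarrow> 'a" where
  "c_val q a k = qint q (3 * k + 1) * const_part q k * param_part q a k"

lemma c_val_eq_quotient: "c_val q a k = c_num q a k / c_den q a k"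
  by (simp add: c_val_def const_part_def param_part_def c_num_def c_den_def c_den_fac_def
      prod_dividef prod.distrib mult_ac)

lemma const_part_0 [simp]: "const_part q 0 = 1" by (simp add: const_part_def)
lemma param_part_0 [simp]: "param_part q a 0 = 1" by (simp add: param_part_def)

text \<open>The factor \<open>1 - q ^ Suc k\<close> stays on the left because it may vanish at a
  root of unity.\<close>

lemma const_part_Suc:
  assumes "1 + q ^ Suc k \<noteq> 0"
  shows "(1 - q ^ Suc k) * const_part q (Suc k) = - ((1 - q ^ (2 * k + 1)) * const_part q k)"
proof -
  have "(1 - q ^ Suc k) * const_part q (Suc k)
    = - ((1 - q ^ Suc k) * central_gbinom q (Suc k)) * (- 1) ^ k
      / ((\<Prod>i<k. 1 + q ^ Suc i) * (1 + q ^ Suc k))"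
    by (simp add: const_part_def mult_ac)
  also have "\<dots> = - ((1 - q ^ (2 * k + 1)) * const_part q k)"
    unfolding central_gbinom_Suc const_part_def using assms by simp
  finally show ?thesis .
qed

lemma param_part_Suc:
  assumes "1 - a * q ^ Suc k \<noteq> 0" "a - q ^ Suc k \<noteq> 0"
  shows "param_part q a (Suc k) * ((1 - a * q ^ Suc k) * (a - q ^ Suc k))
    = param_part q a k * ((1 - a * q ^ (2 * k + 1)) * (a - q ^ (2 * k + 1)))"
  using assms by (simp add: param_part_def)

text \<open>The Gosper certificate. Its factors \<open>1 - a * q ^ (2 * k + 1)\<close> and
  \<open>1 - q ^ (2 * k + 1)\<close> make the boundary term vanish at
  \<open>a * q ^ (2 * k + 1) = 1\<close> and at roots of unity of order
  \<open>2 * k + 1\<close>.\<close>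

definition telescoper :: "'a::field \<Rightarrow> 'a \<Rightarrow> nat \<Rightarrow> 'a" where
  "telescoper q a k = (1 - a * q\<^sup>2) * (a\<^sup>2 * q\<^sup>2 - 1) * q ^ k * (1 - a * q ^ (2 * k + 1)) * (1 - q ^ (2 * k + 1))
     * (const_part q k * param_part q a k)
     / ((1 - q) * (1 - a * q ^ (k + 1)) * (1 - a * q ^ (k + 2)))"

context
  fixes q a :: "'a::field" and K :: nat
  assumes q0: "q \<noteq> 0" and q1: "q \<noteq> 1" and a1: "a \<noteq> 1"
    and A: "\<And>i. 1 \<le> i \<Longrightarrow> i \<le> K + 2 \<Longrightarrow> 1 - a * q ^ i \<noteq> 0"
    and B: "\<And>i. i \<le> 2 * K + 1 \<Longrightarrow> a - q ^ i \<noteq> 0"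
    and C: "\<And>i. i \<le> 2 * K + 1 \<Longrightarrow> a * q - q ^ i \<noteq> 0"
    and D: "\<And>i. i \<le> K \<Longrightarrow> 1 + q ^ i \<noteq> 0"
begin

text \<open>The shift of \<open>a\<close> moves the exponents within each family of factors, so the
  quotient of the two products telescopes to a few boundary factors. These appear
  cross-multiplied.\<close>

lemma param_part_shift:
  "k \<le> K \<Longrightarrow>
     (a * q - q ^ (2 * k)) * (1 - a * q ^ (k + 1)) * (1 - a * q ^ (k + 2)) * (a - 1)
        * param_part q (a * q\<^sup>2) k
     = (1 - a * q ^ (2 * k + 1)) * (1 - a * q\<^sup>2) * (a * q - q ^ k) * (a - q ^ k) * param_part q a k"
proof (induction k)
  case 0
  then show ?case by (simp add: power2_eq_square mult_ac)
next
  case (Suc k)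
  define Q where "Q = q ^ k"
  have pw: "q ^ Suc k = q * Q" "q ^ (2 * k + 1) = q * Q\<^sup>2" "q ^ (2 * k) = Q\<^sup>2" "q ^ (k + 1) = q * Q"
     "q ^ (k + 2) = q\<^sup>2 * Q" "q ^ (Suc k + 2) = q^3 * Q" "q ^ (2 * Suc k + 1) = q^3 * Q\<^sup>2"
     "q ^ (Suc k + 1) = q\<^sup>2 * Q"  "q ^ (2 * Suc k) = q\<^sup>2 * Q\<^sup>2" "q ^ k = Q"
    by (simp_all add: Q_def power_add power_mult power2_eq_square power3_eq_cube mult_ac
        power4_eq_xxxx flip: power_mult_distrib)
  define s s' where "s = param_part q a k" and "s' = param_part q (a * q\<^sup>2) k"
  define r r' where "r = param_part q a (Suc k)" and "r' = param_part q (a * q\<^sup>2) (Suc k)"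
  have IH: "(a * q - Q\<^sup>2) * (1 - a * (q * Q)) * (1 - a * (q\<^sup>2 * Q)) * (a - 1) * s'
     = (1 - a * (q * Q\<^sup>2)) * (1 - a * q\<^sup>2) * (a * q - Q) * (a - Q) * s"
    using Suc.IH Suc.prems unfolding pw s_def s'_def by simp
  have nz: "a * q - Q \<noteq> 0" "1 - a * (q * Q) \<noteq> 0" "1 - a * (q^3 * Q) \<noteq> 0" "a - q * Q \<noteq> 0"
    using C[of k] A[of "Suc k"] A[of "Suc k + 2"] B[of "Suc k"] Suc.prems unfolding pw by simp_all
  have "1 - (a * q\<^sup>2) * q ^ Suc k \<noteq> 0"
    using nz(3) by (simp add: pw power2_eq_square power3_eq_cube mult_ac)
  moreover have "(a * q\<^sup>2) - q ^ Suc k \<noteq> 0"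
  proof -
    have "(a * q\<^sup>2) - q ^ Suc k = q * (a * q - Q)"
      by (simp add: pw power2_eq_square algebra_simps)
    then show ?thesis using nz q0 by simp
  qed
  ultimately have "r' * ((1 - a * q\<^sup>2 * (q * Q)) * (a * q\<^sup>2 - q * Q))
    = s' * ((1 - a * q\<^sup>2 * (q * Q\<^sup>2)) * (a * q\<^sup>2 - q * Q\<^sup>2))"
    unfolding r'_def s'_def using param_part_Suc[of "a * q\<^sup>2" q k] unfolding pw by simp
  then have "q * (r' * ((1 - a * (q ^ 3 * Q)) * (a * q - Q)))
    = q * (s' * ((1 - a * (q ^ 3 * Q\<^sup>2)) * (a * q - Q\<^sup>2)))"
    by (simp add: algebra_simps power2_eq_square power3_eq_cube)
  then have e1: "r' * ((1 - a * (q ^ 3 * Q)) * (a * q - Q))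
    = s' * ((1 - a * (q ^ 3 * Q\<^sup>2)) * (a * q - Q\<^sup>2))"
    using q0 by simp
  have e2: "r * ((1 - a * (q * Q)) * (a - q * Q)) = s * ((1 - a * (q * Q\<^sup>2)) * (a - q * Q\<^sup>2))"
    unfolding r_def s_def using param_part_Suc[of a q k] nz unfolding pw by simp
  \<comment> \<open>The two sides of the claim are compared after multiplication by
    \<open>(a * q - Q) * (1 - a * (q * Q))\<close>, the factor that \<open>e1\<close> and
    \<open>e2\<close> bring in; it is nonzero and cancels at the end.\<close>
  define L where "L = (a * q - q\<^sup>2 * Q\<^sup>2) * (1 - a * (q\<^sup>2 * Q)) * (1 - a * (q ^ 3 * Q)) * (a - 1) * r'"
  define R where "R = (1 - a * (q ^ 3 * Q\<^sup>2)) * (1 - a * q\<^sup>2) * (a * q - q * Q) * (a - q * Q) * r"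
  have "L * ((a * q - Q) * (1 - a * (q * Q)))
    = (a * q - q\<^sup>2 * Q\<^sup>2) * (1 - a * (q\<^sup>2 * Q)) * (a - 1) * (1 - a * (q * Q))
       * (r' * ((1 - a * (q ^ 3 * Q)) * (a * q - Q)))"
    unfolding L_def by (simp only: mult_ac)
  also have "\<dots> = (a * q - q\<^sup>2 * Q\<^sup>2) * (1 - a * (q ^ 3 * Q\<^sup>2))
     * ((a * q - Q\<^sup>2) * (1 - a * (q * Q)) * (1 - a * (q\<^sup>2 * Q)) * (a - 1) * s')"
    unfolding e1 by (simp only: mult_ac)
  also have "\<dots> = (a * q - q\<^sup>2 * Q\<^sup>2) * (1 - a * (q ^ 3 * Q\<^sup>2))
     * ((1 - a * (q * Q\<^sup>2)) * (1 - a * q\<^sup>2) * (a * q - Q) * (a - Q) * s)"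
    unfolding IH ..
  also have "\<dots> = q * (1 - a * (q ^ 3 * Q\<^sup>2)) * (1 - a * q\<^sup>2) * (a * q - Q) * (a - Q)
     * (s * ((1 - a * (q * Q\<^sup>2)) * (a - q * Q\<^sup>2)))"
    by (simp add: power2_eq_square algebra_simps)
  also have "\<dots> = (1 - a * (q ^ 3 * Q\<^sup>2)) * (1 - a * q\<^sup>2) * (a * q - Q) * (q * (a - Q))
     * (r * ((1 - a * (q * Q)) * (a - q * Q)))"
    unfolding e2 by (simp only: mult_ac)
  also have "q * (a - Q) = a * q - q * Q"
    by (simp add: algebra_simps)
  also have "(1 - a * (q ^ 3 * Q\<^sup>2)) * (1 - a * q\<^sup>2) * (a * q - Q) * (a * q - q * Q)
     * (r * ((1 - a * (q * Q)) * (a - q * Q))) = R * ((a * q - Q) * (1 - a * (q * Q)))"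
    unfolding R_def by (simp only: mult_ac)
  finally have "L = R" using nz by simp
  then show ?case unfolding L_def R_def r_def r'_def pw .
qed

lemma one_minus_mult_c_val: "(1 - q) * c_val q b k = (1 - q ^ (3 * k + 1)) * (const_part q k * param_part q b k)"
  unfolding c_val_def by (simp add: qint_mult_one_minus flip: mult.assoc)


text \<open>All four quantities are rational multiples of the same product \<open>x * s\<close>.
  Clearing the denominator \<open>M\<close> leaves a polynomial identity in \<open>a\<close>,
  \<open>q\<close> and \<open>Z\<close>.\<close>

lemma telescoper_Suc:
  assumes "Suc k \<le> K"
  shows "(a - 1) * c_val q (a * q\<^sup>2) (Suc k) + a * (a * q\<^sup>2 - 1) * c_val q a (Suc k) = telescoper q a (Suc k) - telescoper q a k"
proof -
  define Q where "Q = q ^ k"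
  define Z where "Z = q * Q"
  have pw: "q ^ Suc k = Z" "q ^ (k + 1) = Z" "q ^ (k + 2) = q * Z" "q ^ (2 * k + 1) = q * Q\<^sup>2"
    "q ^ (2 * Suc k) = Z\<^sup>2" "q ^ (2 * Suc k + 1) = q * Z\<^sup>2" "q ^ (Suc k + 1) = q * Z"
    "q ^ (Suc k + 2) = q\<^sup>2 * Z" "q ^ (3 * Suc k + 1) = q * Z ^ 3" "q ^ k = Q"
    by (simp_all add: Q_def Z_def power_add power_mult power2_eq_square power3_eq_cube mult_ac
        power4_eq_xxxx flip: power_mult_distrib)
  have nz: "1 - q \<noteq> 0" "a * q - Z\<^sup>2 \<noteq> 0" "1 - a * Z \<noteq> 0" "1 - a * (q * Z) \<noteq> 0"
      "1 - a * (q\<^sup>2 * Z) \<noteq> 0" "a - Z \<noteq> 0" "1 + Z \<noteq> 0" "a - q * Q\<^sup>2 \<noteq> 0"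
    using q1 C[of "2 * Suc k"] A[of "Suc k"] A[of "k + 2"] A[of "Suc k + 2"] B[of "Suc k"]
      B[of "2 * k + 1"] D[of "Suc k"] assms
    unfolding pw by simp_all
  define x y where "x = const_part q (Suc k)" and "y = const_part q k"
  define s s' r where "s = param_part q a (Suc k)" and "s' = param_part q (a * q\<^sup>2) (Suc k)"
    and "r = param_part q a k"
  define P where "P = (a * q - Z\<^sup>2) * (1 - a * (q * Z)) * (1 - a * (q\<^sup>2 * Z))"
  have shift: "(a - 1) * s' * P = (1 - a * (q * Z\<^sup>2)) * (1 - a * q\<^sup>2) * (a * q - Z) * (a - Z) * s"
    using param_part_shift[OF assms] unfolding pw s_def s'_def P_def by (simp only: mult_ac)
  have x: "(1 - Z) * x = - ((1 - q * Q\<^sup>2) * y)"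
    unfolding x_def y_def using const_part_Suc[of q k] nz unfolding pw by simp
  have s: "s * ((1 - a * Z) * (a - Z)) = r * ((1 - a * (q * Q\<^sup>2)) * (a - q * Q\<^sup>2))"
    unfolding s_def r_def using param_part_Suc[of a q k] nz unfolding pw by simp
  define T where "T = (1 - a * q\<^sup>2) * (a\<^sup>2 * q\<^sup>2 - 1)"
  have tele1: "telescoper q a (Suc k) = T * Z * (1 - a * (q * Z\<^sup>2)) * (1 - q * Z\<^sup>2) * (x * s)
      / ((1 - q) * (1 - a * (q * Z)) * (1 - a * (q\<^sup>2 * Z)))"
    unfolding telescoper_def pw T_def x_def s_def ..
  \<comment> \<open>The two recurrences, read backwards, express the certificate at \<open>k\<close>
    through the values at \<open>Suc k\<close>.\<close>
  have tele0: "telescoper q a k = - (T * Z * (1 - Z) * (a - Z) * (x * s))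
      / ((1 - q) * (1 - a * (q * Z)) * (a * q - Z\<^sup>2))"
  proof -
    have "telescoper q a k = T * Q * ((1 - a * (q * Q\<^sup>2)) * r) * ((1 - q * Q\<^sup>2) * y)
        / ((1 - q) * (1 - a * Z) * (1 - a * (q * Z)))"
      unfolding telescoper_def pw T_def y_def r_def by (simp only: mult_ac)
    also have "(1 - q * Q\<^sup>2) * y = - ((1 - Z) * x)"
      using x by simp
    also have "(1 - a * (q * Q\<^sup>2)) * r = s * ((1 - a * Z) * (a - Z)) / (a - q * Q\<^sup>2)"
      unfolding s using nz by (simp add: mult_ac)
    also have "T * Q * (s * ((1 - a * Z) * (a - Z)) / (a - q * Q\<^sup>2)) * - ((1 - Z) * x)
        / ((1 - q) * (1 - a * Z) * (1 - a * (q * Z)))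
      = - (T * Q * (1 - Z) * (a - Z) * (x * s))
      / ((1 - q) * (1 - a * (q * Z)) * (a - q * Q\<^sup>2))"
      using nz by (simp add: mult_ac)
    also have "\<dots> = - (T * (q * Q) * (1 - Z) * (a - Z) * (x * s))
      / ((1 - q) * (1 - a * (q * Z)) * (q * (a - q * Q\<^sup>2)))"
      using q0 by (simp add: mult_ac)
    also have "q * (a - q * Q\<^sup>2) = a * q - Z\<^sup>2"
      by (simp add: Z_def power2_eq_square algebra_simps)
    finally show ?thesis by (simp add: Z_def)
  qed
  define M where "M = (1 - q) * P"
  have M0: "M \<noteq> 0" using nz by (simp add: M_def P_def)
  have c1: "(1 - q) * c_val q a (Suc k) = (1 - q * Z ^ 3) * (x * s)"
    unfolding one_minus_mult_c_val pw x_def s_def ..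
  have "((a - 1) * c_val q (a * q\<^sup>2) (Suc k)) * M = (a - 1) * ((1 - q) * c_val q (a * q\<^sup>2) (Suc k)) * P"
    unfolding M_def by (simp only: mult_ac)
  also have "\<dots> = (1 - q * Z ^ 3) * x * ((a - 1) * s' * P)"
    unfolding one_minus_mult_c_val pw x_def s'_def by (simp only: mult_ac)
  also have "\<dots> = (1 - q * Z ^ 3) * (x * s) * ((1 - a * (q * Z\<^sup>2)) * (1 - a * q\<^sup>2) * (a * q - Z) * (a - Z))"
    unfolding shift by (simp only: mult_ac)
  finally have c2: "((a - 1) * c_val q (a * q\<^sup>2) (Suc k)) * M = (1 - q * Z ^ 3) * (x * s) *
     ((1 - a * (q * Z\<^sup>2)) * (1 - a * q\<^sup>2) * (a * q - Z) * (a - Z))" .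
  have "((a - 1) * c_val q (a * q\<^sup>2) (Suc k) + a * (a * q\<^sup>2 - 1) * c_val q a (Suc k)) * M
    = (1 - q * Z ^ 3) * (x * s) *
     ((1 - a * (q * Z\<^sup>2)) * (1 - a * q\<^sup>2) * (a * q - Z) * (a - Z))
     + a * (a * q\<^sup>2 - 1) * ((1 - q) * c_val q a (Suc k)) * P"
    by (subst distrib_right, subst c2) (simp only: M_def mult_ac)
  also have "\<dots> = (x * s) * ((1 - a * q\<^sup>2) * (1 - q * Z ^ 3) * ((1 - a * (q * Z\<^sup>2)) * (a * q - Z) * (a - Z)
      - a * ((a * q - Z\<^sup>2) * (1 - a * (q * Z)) * (1 - a * (q\<^sup>2 * Z)))))"
    unfolding c1 P_def by algebra
  \<comment> \<open>This polynomial identity is the verification of the certificate.\<close>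
  also have "\<dots> = (x * s) * (T * Z * ((1 - a * (q * Z\<^sup>2)) * (1 - q * Z\<^sup>2) * (a * q - Z\<^sup>2)
      + (1 - Z) * (a - Z) * (1 - a * (q\<^sup>2 * Z))))"
    unfolding T_def by algebra
  also have "\<dots> = telescoper q a (Suc k) * M - telescoper q a k * M"
  proof -
    have t1: "telescoper q a (Suc k) * M = T * Z * (1 - a * (q * Z\<^sup>2)) * (1 - q * Z\<^sup>2) * (x * s) * (a * q - Z\<^sup>2)"
      unfolding tele1 M_def P_def using nz by simp
    have t0: "telescoper q a k * M = - (T * Z * (1 - Z) * (a - Z) * (x * s)) * (1 - a * (q\<^sup>2 * Z))"
      unfolding tele0 M_def P_def using nz by simp
    show ?thesis unfolding t1 t0 by algebra
  qed
  finally show ?thesis using M0 by (metis left_diff_distrib mult_right_cancel)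
qed

text \<open>Summation of \<open>telescoper_Suc\<close> needs no correction at the lower end: at
  index 0 the combination is \<open>a\<^sup>2 * q\<^sup>2 - 1\<close>, which is
  \<open>telescoper q a 0\<close>.\<close>

lemma sum_c_shift:
  "k \<le> K \<Longrightarrow> (a - 1) * (\<Sum>i\<le>k. c_val q (a * q\<^sup>2) i) + a * (a * q\<^sup>2 - 1) * (\<Sum>i\<le>k. c_val q a i) = telescoper q a k"
proof (induction k)
  case 0
  have "1 - q \<noteq> 0" "1 - a * q \<noteq> 0" "1 - a * q\<^sup>2 \<noteq> 0"
    using q1 A[of 1] A[of 2] by auto
  then have "telescoper q a 0 = a\<^sup>2 * q\<^sup>2 - 1"
    by (simp add: telescoper_def numeral_2_eq_2)
  then show ?case
    by (simp add: c_val_def qint_def power2_eq_square algebra_simps)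
next
  case (Suc k)
  then show ?case using telescoper_Suc[of k] by (simp add: algebra_simps)
qed

end

lemma c_val_0 [simp]: "c_val q a 0 = 1"
  by (simp add: c_val_def qint_def)

lemma c_val_eq_0:
  assumes "a * q ^ (2 * m + 1) = 1" "m < k"
  shows "c_val q a k = 0"
proof -
  have "param_part q a k = 0"
    unfolding param_part_def using assms by (intro prod_zero) (auto intro!: bexI[of _ m])
  then show ?thesis by (simp add: c_val_def)
qed

text \<open>Numerator and denominator of each factor both acquire \<open>1 / a\<^sup>2\<close>. This
  carries the evaluation at \<open>q^(-n)\<close> over to \<open>q^n\<close>.\<close>

lemma c_val_inverse:
  assumes "a \<noteq> 0"
  shows "c_val q (inverse a) k = c_val q a k"
proof -
  have "(1 - inverse a * u) * (inverse a - u) / ((1 - inverse a * v) * (inverse a - v))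
      = (1 - a * u) * (a - u) / ((1 - a * v) * (a - v))" for u v
  proof -
    have e: "(1 - inverse a * u) * (inverse a - u) = (1 - a * u) * (a - u) / a\<^sup>2" for u
      using assms by (simp add: field_simps power2_eq_square)
    show ?thesis unfolding e using assms by simp
  qed
  then show ?thesis by (simp only: c_val_def param_part_def)
qed

subsection \<open>The sum at \<open>a = q^(-n)\<close>\<close>

text \<open>Induction with \<open>a\<close> arbitrary: if \<open>a\<close> belongs to
  \<open>Suc m\<close>, then \<open>a * q\<^sup>2\<close> belongs to \<open>m\<close>. Real
  \<open>q > 1\<close> makes the denominators nonzero by size comparison, and such \<open>q\<close>
  suffice for a polynomial identity.\<close>

lemma sum_c_eval:
  fixes q a :: real
  assumes "q > 1" "a * q ^ (2 * m + 1) = 1"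
  shows "(\<Sum>k\<le>m. c_val q a k) = (- 1) ^ m * q ^ m\<^sup>2 * qint q (2 * m + 1)"
  using assms(2)
proof (induction m arbitrary: a)
  case 0
  then show ?case by (simp add: qint_def)
next
  case (Suc m)
  note q = \<open>q > 1\<close>
  define p where "p = q ^ (2 * m + 1)"
  have pq: "q ^ (2 * Suc m + 1) = p * q\<^sup>2"
    by (simp add: p_def power2_eq_square)
  have apq: "a * p * q\<^sup>2 = 1" using Suc.prems unfolding pq by simp
  have p1: "p > 1" using q unfolding p_def by (intro one_less_power) auto
  have pos: "p > 0" "q > 0" using p1 q by auto
  then have a: "a = 1 / (p * q\<^sup>2)" using apq by (simp add: field_simps)
  have a0: "a > 0" using pos by (simp add: a)
  have aq: "a * q < 1"
  proof -
    have "1 * 1 < p * q" using p1 q by (intro mult_strict_mono) auto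
    then show ?thesis using pos by (simp add: a field_simps power2_eq_square)
  qed
  have alt: "a * q ^ i < 1" if "i < 2 * Suc m + 1" for i
  proof -
    have "a * q ^ i < a * q ^ (2 * Suc m + 1)"
      using that q a0 by (intro mult_strict_left_mono power_strict_increasing)
    then show ?thesis using Suc.prems by simp
  qed
  have a1: "a < 1" using alt[of 0] by simp
  have qi: "1 \<le> q ^ i" for i using q by simp
  show ?case
  \<comment> \<open>The shift relation needs \<open>1 - a * q ^ i\<close> nonzero up to
    \<open>i = m + 3\<close>, but it vanishes at \<open>i = 2 * m + 3\<close>. For
    \<open>m = 0\<close> the two collide, so that case is computed directly.\<close>
  proof (cases m)
    case 0
    have "1 - a * q \<noteq> 0" "a - q \<noteq> 0" "1 + q \<noteq> 0" "1 - q \<noteq> 0"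
      using aq a1 q by auto
    moreover have "const_part q 1 = - 1"
    proof -
      have "(1 - q) * const_part q 1 = (1 - q) * (- 1)"
        using const_part_Suc[of q 0] \<open>1 + q \<noteq> 0\<close> by simp
      then show ?thesis using \<open>1 - q \<noteq> 0\<close> by (metis mult_left_cancel)
    qed
    moreover have "param_part q a 1 = 1"
      using param_part_Suc[of a q 0] calculation by simp
    ultimately show ?thesis
      by (simp add: 0 c_val_def qint_def numeral_eq_Suc algebra_simps)
  next
    case (Suc m')
    have "(a - 1) * (\<Sum>i\<le>Suc m. c_val q (a * q\<^sup>2) i) + a * (a * q\<^sup>2 - 1) * (\<Sum>i\<le>Suc m. c_val q a i)
      = telescoper q a (Suc m)"
    proof (rule sum_c_shift[where K = "Suc m"])
      show "1 - a * q ^ i \<noteq> 0" if "1 \<le> i" "i \<le> Suc m + 2" for i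
        using alt[of i] that Suc by simp
      show "a - q ^ i \<noteq> 0" "a * q - q ^ i \<noteq> 0" "1 + q ^ i \<noteq> 0" for i
        using qi[of i] a1 aq by auto
    qed (use q a1 in auto)
    also have "telescoper q a (Suc m) = 0"
      using Suc.prems by (simp add: telescoper_def del: power_Suc)
    also have "(\<Sum>i\<le>Suc m. c_val q (a * q\<^sup>2) i) = (- 1) ^ m * q ^ m\<^sup>2 * qint q (2 * m + 1)"
    proof -
      \<comment> \<open>For the parameter \<open>a * q\<^sup>2\<close> the term of index
        \<open>Suc m\<close> is zero, so the induction hypothesis also gives the sum up to
        \<open>Suc m\<close>.\<close>
      have ap: "a * q\<^sup>2 * q ^ (2 * m + 1) = 1" using apq by (simp add: p_def mult_ac)
      show ?thesis using Suc.IH[OF ap] c_val_eq_0[OF ap, of "Suc m"] by simp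
    qed
    \<comment> \<open>With \<open>a * p * q\<^sup>2 = 1\<close>, multiplication by
      \<open>p * q\<^sup>2 * p\<close> eliminates \<open>a\<close>.\<close>
    finally have "(p * q\<^sup>2 * p) * ((a - 1) * ((- 1) ^ m * q ^ m\<^sup>2 * qint q (2 * m + 1))
        + a * (a * q\<^sup>2 - 1) * (\<Sum>i\<le>Suc m. c_val q a i)) = 0"
      by simp
    then have "(a * p * q\<^sup>2 - p * q\<^sup>2) * p * ((- 1) ^ m * q ^ m\<^sup>2 * qint q (2 * m + 1))
        + (a * p * q\<^sup>2) * (a * p * q\<^sup>2 - p) * (\<Sum>i\<le>Suc m. c_val q a i) = 0"
      by (simp add: algebra_simps)
    then have "(1 - q) * ((1 - p * q\<^sup>2) * p * ((- 1) ^ m * q ^ m\<^sup>2 * qint q (2 * m + 1))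
        + (1 - p) * (\<Sum>i\<le>Suc m. c_val q a i)) = 0"
      unfolding apq mult_1 by (simp only: mult_zero_right)
    then have "(1 - p * q\<^sup>2) * p * ((- 1) ^ m * q ^ m\<^sup>2 * ((1 - q) * qint q (2 * m + 1)))
        + (1 - q) * ((1 - p) * (\<Sum>i\<le>Suc m. c_val q a i)) = 0"
      by (simp only: distrib_left mult_ac)
    then have "(1 - p) * ((1 - q) * (\<Sum>i\<le>Suc m. c_val q a i))
        = (1 - p) * ((1 - q) * qint q (2 * Suc m + 1) * ((- 1) ^ Suc m * (q ^ m\<^sup>2 * p)))"
      unfolding qint_mult_one_minus pq p_def[symmetric] by (simp add: algebra_simps)
    then have "(1 - q) * (\<Sum>i\<le>Suc m. c_val q a i)
        = (1 - q) * (qint q (2 * Suc m + 1) * ((- 1) ^ Suc m * (q ^ m\<^sup>2 * p)))"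
      unfolding mult.assoc by (rule mult_left_cancel[THEN iffD1, rotated]) (use p1 in simp)
    moreover have e: "q ^ m\<^sup>2 * p = q ^ (Suc m)\<^sup>2"
      unfolding p_def by (simp add: power2_eq_square mult_2 add_ac flip: power_add)
    ultimately have "(1 - q) * (\<Sum>i\<le>Suc m. c_val q a i)
        = (1 - q) * ((- 1) ^ Suc m * q ^ (Suc m)\<^sup>2 * qint q (2 * Suc m + 1))"
      unfolding e by (simp only: mult_ac)
    then show ?thesis
      by (rule mult_left_cancel[THEN iffD1, rotated]) (use q in simp)
  qed
qed

section \<open>Truncated convolution sums\<close>

text \<open>Grouping by \<open>j\<close> exposes truncated single sums of length
  \<open>n - j\<close>. Positivity of \<open>n\<close> matters: for \<open>n = 0\<close> the range
  \<open>0..n-1\<close> would still contain 0.\<close>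

lemma sum_convolution:
  fixes f :: "nat \<Rightarrow> 'a::comm_ring_1"
  assumes "n > 0"
  shows "(\<Sum>k=0..n-1. \<Sum>j=0..k. f j * f (k - j)) = (\<Sum>j<n. f j * (\<Sum>i<n - j. f i))"
proof -
  have "(\<Sum>j<n. f j * (\<Sum>i<n - j. f i)) = (\<Sum>(j, i)\<in>Sigma {..<n} (\<lambda>j. {..<n - j}). f j * f i)"
    by (simp add: sum_distrib_left sum.Sigma)
  also have "Sigma {..<n} (\<lambda>j. {..<n - j}) = {(j, i). j + i < n}"
    by auto
  also have "(\<Sum>(j, i)\<in>{(j, i). j + i < n}. f j * f i) = (\<Sum>k<n. \<Sum>j\<le>k. f j * f (k - j))"
    by (rule sum.triangle_reindex)
  finally show ?thesis
    using assms by (cases n) (simp_all add: atMost_atLeast0 lessThan_Suc_atMost)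
qed

text \<open>When \<open>j \<le> m\<close>, the inner range \<open>i < 2 * m + 1 - j\<close> already
  covers the whole support of \<open>f\<close>, so truncation loses nothing.\<close>

lemma sum_convolution_square:
  fixes f :: "nat \<Rightarrow> 'a::comm_ring_1"
  assumes "\<And>k. m < k \<Longrightarrow> f k = 0"
  shows "(\<Sum>k=0..2*m. \<Sum>j=0..k. f j * f (k - j)) = (\<Sum>k\<le>m. f k)\<^sup>2"
proof -
  have part: "sum f {..<r} = (\<Sum>k\<le>m. f k)" if "m < r" for r
    using that assms by (intro sum.mono_neutral_right) auto
  have "(\<Sum>k=0..2*m. \<Sum>j=0..k. f j * f (k - j)) = (\<Sum>j<2*m+1. f j * (\<Sum>i<2*m+1 - j. f i))"
    using sum_convolution[of "2*m+1" f] by simp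
  also have "\<dots> = (\<Sum>j<2*m+1. f j * (\<Sum>k\<le>m. f k))"
  proof (rule sum.cong)
    fix j
    show "f j * (\<Sum>i<2*m+1 - j. f i) = f j * (\<Sum>k\<le>m. f k)"
    proof (cases "m < j")
      case False
      then show ?thesis using part[of "2*m+1-j"] by simp
    qed (simp add: assms)
  qed simp
  also have "\<dots> = (\<Sum>k\<le>m. f k)\<^sup>2"
    using part[of "2*m+1"] by (simp add: power2_eq_square flip: sum_distrib_right)
  finally show ?thesis .
qed

subsection \<open>The sum at roots of unity\<close>

context
  fixes z :: complex and h :: nat
  assumes z: "z ^ (2 * h + 1) = 1" and z1: "z \<noteq> 1"
    and prim: "\<And>i. 0 < i \<Longrightarrow> i < 2 * h + 1 \<Longrightarrow> z ^ i \<noteq> 1"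
begin

lemma norm_z: "norm z = 1"
proof -
  have "norm z ^ (2 * h + 1) = 1" using z by (metis norm_one norm_power)
  then show ?thesis by (metis Suc_eq_plus1 norm_ge_zero power_eq_imp_eq_base power_one zero_le_one zero_less_Suc)
qed

lemma z_nonzero: "z \<noteq> 0"
  using norm_z by auto

text \<open>The order is odd: raising \<open>z ^ i = - 1\<close> to the power
  \<open>2 * h + 1\<close> would give \<open>1 = - 1\<close>.\<close>

lemma one_plus_z: "1 + z ^ i \<noteq> 0"
proof
  assume "1 + z ^ i = 0"
  then have "z ^ i = - 1" by (simp add: add_eq_0_iff)
  then have "(z ^ (2 * h + 1)) ^ i = (- 1) ^ (2 * h + 1)"
    by (metis mult.commute power_mult)
  then show False unfolding z by simp
qed

text \<open>Since \<open>norm z = 1\<close>, taking \<open>norm b > 1\<close> avoids every zero of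
  the denominators, and infinitely many such \<open>b\<close> remain for the polynomial argument in
  \<open>a\<close>.\<close>

lemma generic_nonzero:
  assumes "norm b > 1"
  shows "1 - b * z ^ i \<noteq> 0" "b - z ^ i \<noteq> 0" "b * z - z ^ i \<noteq> 0"
proof -
  have "norm (b * z ^ i) \<noteq> norm (1::complex)" "norm b \<noteq> norm (z ^ i)" "norm (b * z) \<noteq> norm (z ^ i)"
    using assms norm_z by (auto simp: norm_mult norm_power)
  then show "1 - b * z ^ i \<noteq> 0" "b - z ^ i \<noteq> 0" "b * z - z ^ i \<noteq> 0"
    by (metis eq_iff_diff_eq_0)+
qed

lemma sum_c_root_shift:
  assumes "norm b > 1"
  shows "(b - 1) * (\<Sum>i\<le>h. c_val z (b * z\<^sup>2) i) = - (b * (b * z\<^sup>2 - 1) * (\<Sum>i\<le>h. c_val z b i))"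
proof -
  have "(b - 1) * (\<Sum>i\<le>h. c_val z (b * z\<^sup>2) i) + b * (b * z\<^sup>2 - 1) * (\<Sum>i\<le>h. c_val z b i) = telescoper z b h"
    by (rule sum_c_shift[where K = h])
      (use assms z_nonzero z1 one_plus_z generic_nonzero in auto)
  also have "telescoper z b h = 0"
    unfolding telescoper_def z by simp
  finally show ?thesis by (simp add: add_eq_0_iff)
qed

text \<open>The factors \<open>b * z ^ (2 * i) - 1\<close> of the successive shifts telescope, while
  the multipliers \<open>b * z ^ (2 * i)\<close> for \<open>i < j\<close> multiply to
  \<open>b ^ j * z ^ (j * (j - 1))\<close>.\<close>

lemma sum_c_root_shift_iterate:
  assumes "norm b > 1"
  shows "(b - 1) * (\<Sum>i\<le>h. c_val z (b * z ^ (2 * j)) i)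
    = (- 1) ^ j * b ^ j * z ^ (j * (j - 1)) * (b * z ^ (2 * j) - 1) * (\<Sum>i\<le>h. c_val z b i)"
proof (induction j)
  case 0
  then show ?case by simp
next
  case (Suc j)
  define b' where "b' = b * z ^ (2 * j)"
  have b': "norm b' > 1" using assms norm_z by (simp add: b'_def norm_mult norm_power)
  then have nz: "b' - 1 \<noteq> 0" by auto
  have bz: "b' * z\<^sup>2 = b * z ^ (2 * Suc j)" by (simp add: b'_def power2_eq_square)
  have "j * (j - 1) + 2 * j = Suc j * (Suc j - 1)"
    by (cases j) auto
  then have zj: "z ^ (j * (j - 1)) * z ^ (2 * j) = z ^ (Suc j * (Suc j - 1))"
    by (simp only: flip: power_add)
  have "(b' - 1) * ((b - 1) * (\<Sum>i\<le>h. c_val z (b' * z\<^sup>2) i))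
     = (b - 1) * ((b' - 1) * (\<Sum>i\<le>h. c_val z (b' * z\<^sup>2) i))"
    by (simp only: mult_ac)
  also have "\<dots> = - (b' * (b' * z\<^sup>2 - 1) * ((b - 1) * (\<Sum>i\<le>h. c_val z b' i)))"
    unfolding sum_c_root_shift[OF b'] by simp
  also have "\<dots> = - (b' * (b' * z\<^sup>2 - 1) * ((- 1) ^ j * b ^ j * z ^ (j * (j - 1)) * (b' - 1)
      * (\<Sum>i\<le>h. c_val z b i)))"
    using Suc.IH unfolding b'_def by simp
  also have "\<dots> = (b' - 1) * ((- 1) ^ Suc j * b ^ Suc j * (z ^ (j * (j - 1)) * z ^ (2 * j)) * (b' * z\<^sup>2 - 1)
      * (\<Sum>i\<le>h. c_val z b i))"
    unfolding b'_def by (simp add: mult_ac)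
  finally have "(b - 1) * (\<Sum>i\<le>h. c_val z (b' * z\<^sup>2) i)
    = (- 1) ^ Suc j * b ^ Suc j * (z ^ (j * (j - 1)) * z ^ (2 * j)) * (b' * z\<^sup>2 - 1) * (\<Sum>i\<le>h. c_val z b i)"
    by (rule mult_left_cancel[OF nz, THEN iffD1])
  then show ?case unfolding zj bz .
qed

text \<open>After \<open>d = 2 * h + 1\<close> shifts the parameter returns to \<open>b\<close>, and
  the odd number of sign changes leaves the factor \<open>- (b ^ d)\<close>. As
  \<open>norm b > 1\<close>, it differs from 1.\<close>

lemma sum_c_root:
  assumes "norm b > 1"
  shows "(\<Sum>i\<le>h. c_val z b i) = 0"
proof -
  define d where "d = 2 * h + 1"
  have zd: "z ^ (m * d) = 1" "z ^ (d * m) = 1" for m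
    unfolding d_def using z by (metis mult.commute power_mult power_one)+
  have "(b - 1) * (\<Sum>i\<le>h. c_val z b i) = - (b ^ d * (b - 1) * (\<Sum>i\<le>h. c_val z b i))"
    using sum_c_root_shift_iterate[OF assms, of d] unfolding zd by (simp add: d_def)
  then have "(b - 1) * (1 + b ^ d) * (\<Sum>i\<le>h. c_val z b i) = 0"
    by (simp add: algebra_simps)
  moreover have "1 + b ^ d \<noteq> 0"
  proof
    assume "1 + b ^ d = 0"
    then have "norm (b ^ d) = 1"
      by (metis add_eq_0_iff norm_minus_cancel norm_one)
    moreover have "norm b ^ d > 1" using assms by (intro one_less_power) (auto simp: d_def)
    ultimately show False by (simp add: norm_power)
  qed
  moreover have "b - 1 \<noteq> 0" using assms by auto
  ultimately show ?thesis by simp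
qed

text \<open>The recurrence produces the factor \<open>1 - z ^ (2 * h + 1) = 0\<close> on passing
  from \<open>h\<close> to \<open>h + 1\<close>; up to index \<open>2 * h\<close> the divisors
  \<open>1 - z ^ Suc r\<close> are nonzero, so the zero persists.\<close>

lemma const_part_root_eq_0: "h < r \<Longrightarrow> r < 2 * h + 1 \<Longrightarrow> const_part z r = 0"
proof (induction r)
  case (Suc r)
  have "1 - z ^ Suc r \<noteq> 0"
    using prim[of "Suc r"] Suc.prems by simp
  moreover have "(1 - z ^ (2 * r + 1)) * const_part z r = 0"
  proof (cases "r = h")
    case True
    then show ?thesis using z by simp
  next
    case False
    then show ?thesis using Suc by simp
  qed
  ultimately show ?case
    using const_part_Suc[OF one_plus_z, of r] by (metis mult_eq_0_iff neg_0_equal_iff_equal)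
qed simp

text \<open>With \<open>z ^ k = 1\<close> the recurrences at \<open>k + r\<close> and
  \<open>r\<close> coincide, so the term splits off its value at \<open>k\<close>.\<close>

lemma c_root_periodic:
  assumes "r < 2 * h + 1"
  shows "c_val z b (l * (2 * h + 1) + r) = c_val z b (l * (2 * h + 1)) * c_val z b r"
proof -
  define k where "k = l * (2 * h + 1)"
  have zk: "z ^ k = 1" unfolding k_def using z by (metis mult.commute power_mult power_one)
  then have zk2: "z ^ (2 * k) = 1" "z ^ (3 * k) = 1"
    by (simp_all add: power_mult mult.commute[of _ k])
  have "const_part z (k + r) = const_part z k * const_part z r"
    using assms
  proof (induction r)
    case (Suc r)
    have "(1 - z ^ Suc r) * const_part z (k + Suc r) = (1 - z ^ Suc (k + r)) * const_part z (Suc (k + r))"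
      by (simp add: power_add zk)
    also have "\<dots> = - ((1 - z ^ (2 * (k + r) + 1)) * const_part z (k + r))"
      by (rule const_part_Suc[OF one_plus_z])
    also have "\<dots> = const_part z k * - ((1 - z ^ (2 * r + 1)) * const_part z r)"
      using Suc by (simp add: power_add zk2 distrib_left)
    also have "\<dots> = (1 - z ^ Suc r) * (const_part z k * const_part z (Suc r))"
      unfolding const_part_Suc[OF one_plus_z, symmetric] by simp
    finally show ?case using prim[of "Suc r"] Suc.prems by simp
  qed simp
  moreover have "param_part z b (k + r) = param_part z b k * param_part z b r"
    by (induction r) (simp_all add: param_part_def power_add zk zk2 distrib_left)
  moreover have "qint z (3 * (k + r) + 1) = qint z (3 * k + 1) * qint z (3 * r + 1)"
  proof -
    have "(1 - z) * qint z (3 * k + 1) = (1 - z) * 1"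
      unfolding qint_mult_one_minus by (simp add: power_add zk2)
    then have "qint z (3 * k + 1) = 1" using z1 by simp
    moreover have "(1 - z) * qint z (3 * (k + r) + 1) = (1 - z) * qint z (3 * r + 1)"
      unfolding qint_mult_one_minus by (simp add: power_add zk2 distrib_left)
    ultimately show ?thesis using z1 by simp
  qed
  ultimately show ?thesis unfolding k_def[symmetric] c_val_def by (simp add: mult_ac)
qed

text \<open>Each full period is a multiple of the vanishing sum up to \<open>h\<close>. So is a last
  piece longer than \<open>h\<close>, since the terms from \<open>h + 1\<close> to
  \<open>2 * h\<close> are zero.\<close>

lemma sum_c_root_block:
  assumes "norm b > 1" "h < r" "r \<le> 2 * h + 1"
  shows "(\<Sum>i<l * (2 * h + 1) + r. c_val z b i) = 0"
proof -
  have concat: "(\<Sum>i<m + r. c_val z b i) = (\<Sum>i<m. c_val z b i) + (\<Sum>i<r. c_val z b (m + i))" for m r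
    by (induction r) (simp_all add: add.assoc)
  have split: "(\<Sum>i<l * (2 * h + 1) + r. c_val z b i) = (\<Sum>i<l * (2 * h + 1). c_val z b i)"
    if r: "h < r" "r \<le> 2 * h + 1" for l r
  proof -
    have "(\<Sum>i<r. c_val z b i) = (\<Sum>i\<le>h. c_val z b i)"
      using r const_part_root_eq_0 by (intro sum.mono_neutral_right) (auto simp: c_val_def)
    then have "(\<Sum>i<r. c_val z b i) = 0" using sum_c_root[OF assms(1)] by simp
    moreover have "(\<Sum>i<r. c_val z b (l * (2 * h + 1) + i)) = c_val z b (l * (2 * h + 1)) * (\<Sum>i<r. c_val z b i)"
      unfolding sum_distrib_left using r by (intro sum.cong refl c_root_periodic) auto
    ultimately show ?thesis
      by (simp add: concat)
  qed
  have "(\<Sum>i<l * (2 * h + 1). c_val z b i) = 0"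
  proof (induction l)
    case (Suc l)
    then show ?case using split[of "2 * h + 1" l] by (simp add: add_ac)
  qed simp
  then show ?thesis using split[OF assms(2,3)] by simp
qed

text \<open>For each \<open>j\<close> one factor vanishes: the term itself if
  \<open>j mod d > h\<close>, and otherwise the inner sum, whose length is a multiple of
  \<open>d\<close> plus \<open>d - j mod d > h\<close>.\<close>

lemma sum_convolution_root:
  assumes "norm b > 1" "N > 0"
  shows "(\<Sum>k=0..N * (2 * h + 1) - 1. \<Sum>j=0..k. c_val z b j * c_val z b (k - j)) = 0"
proof -
  define d where "d = 2 * h + 1"
  have "(\<Sum>k=0..N * d - 1. \<Sum>j=0..k. c_val z b j * c_val z b (k - j))
    = (\<Sum>j<N * d. c_val z b j * (\<Sum>i<N * d - j. c_val z b i))"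
    using assms by (intro sum_convolution) (simp add: d_def)
  also have "\<dots> = 0"
  proof (rule sum.neutral, intro ballI)
    fix j assume "j \<in> {..<N * d}"
    then have lN: "j div d < N" by (simp add: less_mult_imp_div_less)
    have j: "j = j div d * d + j mod d" by simp
    have rd: "j mod d < d" by (simp add: d_def)
    show "c_val z b j * (\<Sum>i<N * d - j. c_val z b i) = 0"
    proof (cases "h < j mod d")
      case True
      then have "c_val z b (j mod d) = 0"
        using const_part_root_eq_0 rd by (simp add: c_val_def d_def)
      then have "c_val z b j = 0"
        using c_root_periodic[of "j mod d" b "j div d"] rd j unfolding d_def by simp
      then show ?thesis by simp
    next
      case False
      obtain M where M: "N = j div d + Suc M" using lN less_imp_Suc_add by fastforce
      have "N * d - j = M * d + (d - j mod d)"
      proof -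
        have "N * d = j div d * d + M * d + d"
          unfolding M by (simp add: algebra_simps)
        then show ?thesis using rd j by linarith
      qed
      then have "(\<Sum>i<N * d - j. c_val z b i) = 0"
        using sum_c_root_block[OF assms(1), of "d - j mod d" M] False by (simp add: d_def)
      then show ?thesis by simp
    qed
  qed
  finally show ?thesis unfolding d_def .
qed

end

subsection \<open>Evaluation homomorphisms\<close>

locale comm_ring_hom =
  fixes f :: "'a::comm_ring_1 \<Rightarrow> 'b::comm_ring_1"
  assumes hom_add: "f (x + y) = f x + f y"
    and hom_mult: "f (x * y) = f x * f y"
    and hom_1: "f 1 = 1"
begin

lemma hom_0: "f 0 = 0"
  using hom_add[of 0 0] by simp

lemma hom_minus: "f (- x) = - f x"
  using hom_add[of x "- x"] hom_0 by (simp add: eq_neg_iff_add_eq_0 add.commute)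

lemma hom_diff: "f (x - y) = f x - f y"
  using hom_add[of x "- y"] by (simp add: hom_minus)

lemma hom_power: "f (x ^ n) = f x ^ n"
  by (induction n) (simp_all add: hom_1 hom_mult)

lemma hom_sum: "f (\<Sum>i\<in>I. g i) = (\<Sum>i\<in>I. f (g i))"
  by (induction I rule: infinite_finite_induct) (simp_all add: hom_0 hom_add)

lemma hom_prod: "f (\<Prod>i\<in>I. g i) = (\<Prod>i\<in>I. f (g i))"
  by (induction I rule: infinite_finite_induct) (simp_all add: hom_1 hom_mult)

lemma hom_qint: "f (qint q m) = qint (f q) m"
  by (simp add: qint_def hom_sum hom_power)

lemma hom_gbinom: "f (gbinom q n k) = gbinom (f q) n k"
  by (induction q n k rule: gbinom.induct) (simp_all add: hom_0 hom_1 hom_add hom_mult hom_power)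

lemmas homs = hom_add hom_mult hom_1 hom_0 hom_minus hom_diff hom_power hom_sum hom_prod
  hom_qint hom_gbinom

lemma hom_c_num: "f (c_num q a k) = c_num (f q) (f a) k"
  by (simp add: c_num_def central_gbinom_def homs)

lemma hom_c_den: "f (c_den q a k) = c_den (f q) (f a) k"
  by (simp add: c_den_def c_den_fac_def homs)

text \<open>Applied to \<open>of_rat\<close> this yields evaluation in \<open>q\<close>; applied to
  that, evaluation in both \<open>q\<close> and \<open>a\<close>.\<close>

lemma hom_eval: "comm_ring_hom (\<lambda>p. poly (map_poly f p) s)"
proof
  define F where "F = (\<lambda>p. poly (map_poly f p) s)"
  have F_pCons: "F (pCons c p) = f c + s * F p" for c p
    by (simp add: F_def map_poly_pCons hom_0)
  have F_0: "F 0 = 0" by (simp add: F_def)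
  show F_add: "F (p + q) = F p + F q" for p q
  proof (induction p q rule: poly_induct2)
    case (pCons a p b q)
    then show ?case by (simp add: F_pCons hom_add algebra_simps)
  qed (simp add: F_0)
  have F_smult: "F (smult c p) = f c * F p" for c p
    by (induction p) (simp_all add: F_0 F_pCons hom_mult algebra_simps)
  show "F (p * q) = F p * F q" for p q
    by (induction p) (simp_all add: F_0 F_pCons F_add F_smult hom_0 algebra_simps)
  show "F 1 = 1"
    by (simp add: F_def hom_1 one_poly_eq_simps flip: one_pCons)
qed

end

lemma of_rat_hom: "comm_ring_hom (of_rat :: rat \<Rightarrow> 'a::field_char_0)"
  by unfold_locales (simp_all add: of_rat_add of_rat_mult)

lemma to_fract_hom: "comm_ring_hom (to_fract :: 'a::idom \<Rightarrow> 'a fract)"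
  by unfold_locales simp_all

definition eval_q :: "'a::field_char_0 \<Rightarrow> rat poly \<Rightarrow> 'a" where
  "eval_q x p = poly (map_poly of_rat p) x"

definition eval_qa :: "'a::field_char_0 \<Rightarrow> 'a \<Rightarrow> qa_poly \<Rightarrow> 'a" where
  "eval_qa x y p = poly (map_poly (eval_q x) p) y"

lemma eval_q_hom: "comm_ring_hom (eval_q x)"
  unfolding eval_q_def by (rule comm_ring_hom.hom_eval[OF of_rat_hom])

lemma eval_qa_hom: "comm_ring_hom (eval_qa x y)"
  unfolding eval_qa_def by (rule comm_ring_hom.hom_eval[OF eval_q_hom])

lemma eval_q_0 [simp]: "eval_q x 0 = 0"
  by (rule comm_ring_hom.hom_0[OF eval_q_hom])

lemma eval_qa_const: "eval_qa x y [:p:] = eval_q x p"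
  by (simp add: eval_qa_def map_poly_pCons)

lemma eval_qa_gens [simp]: "eval_qa x y q_poly = x" "eval_qa x y a_poly = y"
  by (simp_all add: eval_qa_def eval_q_def q_poly_def a_poly_def map_poly_pCons
      comm_ring_hom.hom_1[OF eval_q_hom, unfolded eval_q_def])

section \<open>Zeros of the cleared numerator\<close>

text \<open>The numerator of the difference over the common denominator \<open>(c_den q a (n - 1))\<^sup>2\<close>.\<close>

definition defect :: "nat \<Rightarrow> 'a::comm_ring_1 \<Rightarrow> 'a \<Rightarrow> 'a" where
  "defect n q a =
     (\<Sum>k=0..n-1. \<Sum>j=0..k.
        c_num q a j * (\<Prod>i=j..<n-1. c_den_fac q a i)
        * (c_num q a (k - j) * (\<Prod>i=k-j..<n-1. c_den_fac q a i)))
     - q ^ ((n - 1)\<^sup>2 div 2) * (qint q n)\<^sup>2 * (c_den q a (n - 1))\<^sup>2"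

lemma (in comm_ring_hom) hom_defect: "f (defect n q a) = defect n (f q) (f a)"
  by (simp add: defect_def hom_sum hom_diff hom_mult hom_power hom_prod hom_c_num hom_c_den hom_qint
     c_den_fac_def hom_1 hom_add)

text \<open>The tail products complete each \<open>c_den q a j\<close> to
  \<open>c_den q a (n - 1)\<close>, so each summand is the square of that denominator times a
  product of two values of \<open>c_val\<close>.\<close>

lemma defect_eq:
  fixes q a :: "'a::field"
  assumes "c_den q a (n - 1) \<noteq> 0"
  shows "defect n q a = (c_den q a (n - 1))\<^sup>2 *
    ((\<Sum>k=0..n-1. \<Sum>j=0..k. c_val q a j * c_val q a (k - j)) - q ^ ((n - 1)\<^sup>2 div 2) * (qint q n)\<^sup>2)"
proof -
  have *: "c_num q a j * (\<Prod>i=j..<n-1. c_den_fac q a i) = c_den q a (n - 1) * c_val q a j"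
    if "j \<le> n - 1" for j
  proof -
    have "c_den q a (n - 1) = c_den q a j * (\<Prod>i=j..<n-1. c_den_fac q a i)"
      unfolding c_den_def using prod.atLeastLessThan_concat[of 0 j "n-1" "c_den_fac q a"] that
      by (simp add: atLeast0LessThan)
    then show ?thesis using assms by (auto simp: c_val_eq_quotient)
  qed
  have "(\<Sum>k=0..n-1. \<Sum>j=0..k.
        c_num q a j * (\<Prod>i=j..<n-1. c_den_fac q a i)
        * (c_num q a (k - j) * (\<Prod>i=k-j..<n-1. c_den_fac q a i)))
     = (\<Sum>k=0..n-1. \<Sum>j=0..k. (c_den q a (n - 1))\<^sup>2 * (c_val q a j * c_val q a (k - j)))"
  proof (intro sum.cong refl, goal_cases)
    case (1 k j)
    then have "j \<le> n - 1" "k - j \<le> n - 1" by auto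
    then show ?case by (simp only: *) (simp add: power2_eq_square mult_ac)
  qed
  then show ?thesis
    unfolding defect_def by (simp add: sum_distrib_left right_diff_distrib mult_ac)
qed

text \<open>At \<open>a = q^(-n)\<close> only the first \<open>m + 1\<close> terms survive, so the
  double sum is the square of the single sum and the sign \<open>(- 1) ^ m\<close>
  disappears.\<close>

lemma defect_inverse_power:
  fixes q :: real
  assumes "odd n" "q > 1" "a = inverse (q ^ n) \<or> a = q ^ n"
  shows "defect n q a = 0"
proof -
  obtain m where n: "n = 2 * m + 1" using assms(1) oddE by blast
  have sq: "(\<Sum>k=0..n-1. \<Sum>j=0..k. c_val q b j * c_val q b (k - j)) = q ^ ((n - 1)\<^sup>2 div 2) * (qint q n)\<^sup>2"
    if b: "b * q ^ n = 1" for b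
  proof -
    have "(\<Sum>k=0..n-1. \<Sum>j=0..k. c_val q b j * c_val q b (k - j)) = (\<Sum>k\<le>m. c_val q b k)\<^sup>2"
      using sum_convolution_square[of m "c_val q b"] c_val_eq_0[of b q m] b n by simp
    also have "\<dots> = (q ^ m\<^sup>2)\<^sup>2 * (qint q n)\<^sup>2"
      using sum_c_eval[OF assms(2), of b m] b n by (simp add: power_mult_distrib flip: power_mult)
    \<comment> \<open>The halving is exact: for \<open>n = 2 * m + 1\<close>,
      \<open>(n - 1)\<^sup>2 div 2 = 2 * m\<^sup>2\<close>.\<close>
    also have "(q ^ m\<^sup>2)\<^sup>2 = q ^ ((n - 1)\<^sup>2 div 2)"
      by (simp add: n power_mult_distrib flip: power_mult) (simp add: mult.commute)
    finally show ?thesis .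
  qed
  have q0: "q > 0" using assms by simp
  have lt: "q ^ i < q ^ n" "q ^ i \<ge> 1" if "i < n" for i
    using that assms by (auto intro: power_strict_increasing)
  have n1: "q ^ n > 1" using assms n by (simp add: one_less_power del: power_Suc)
  show ?thesis
    using assms(3)
  proof
    assume a: "a = inverse (q ^ n)"
    then have aq: "a * q ^ n = 1" using q0 by simp
    have "1 - a * q ^ Suc i \<noteq> 0" "a - q ^ Suc i \<noteq> 0" "1 + q ^ Suc i \<noteq> 0" if "i < n - 1" for i
    proof -
      have "a * q ^ Suc i < a * q ^ n"
        using that q0 lt(1)[of "Suc i"] by (intro mult_strict_left_mono) (auto simp: a)
      then show "1 - a * q ^ Suc i \<noteq> 0" using aq by simp
      have "a < 1" using n1 by (simp add: a inverse_less_1_iff)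
      moreover have "1 \<le> q ^ Suc i" using that by (intro lt) simp
      ultimately show "a - q ^ Suc i \<noteq> 0" "1 + q ^ Suc i \<noteq> 0" by linarith+
    qed
    then have nz: "c_den q a (n - 1) \<noteq> 0"
      by (simp add: c_den_def c_den_fac_def del: power_Suc)
    show ?thesis unfolding defect_eq[OF nz] sq[OF aq] by simp
  next
    assume a: "a = q ^ n"
    then have aq: "inverse a * q ^ n = 1" "a \<noteq> 0" using q0 by simp_all
    have "1 - a * q ^ Suc i \<noteq> 0" "a - q ^ Suc i \<noteq> 0" "1 + q ^ Suc i \<noteq> 0" if "i < n - 1" for i
    proof -
      have i: "Suc i < n" using that by simp
      have "1 * 1 < a * q ^ Suc i"
        using lt(2)[OF i] n1 unfolding a by (intro mult_less_le_imp_less) auto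
      then show "1 - a * q ^ Suc i \<noteq> 0" by simp
      show "a - q ^ Suc i \<noteq> 0" "1 + q ^ Suc i \<noteq> 0"
        using lt[OF i] unfolding a by linarith+
    qed
    then have nz: "c_den q a (n - 1) \<noteq> 0"
      by (simp add: c_den_def c_den_fac_def del: power_Suc)
    \<comment> \<open>The evaluation \<open>sq\<close> applies to \<open>inverse a\<close>; the
      symmetry of \<open>c_val\<close> transfers it to \<open>a\<close>.\<close>
    show ?thesis
      unfolding defect_eq[OF nz] sq[OF aq(1), unfolded c_val_inverse[OF aq(2)]] by simp
  qed
qed

text \<open>The order \<open>d\<close> of \<open>z\<close> divides \<open>n\<close>, hence is odd,
  and the summation range consists of whole periods. The double sum and \<open>qint z n\<close>
  vanish separately.\<close>

lemma defect_root_of_unity: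
  fixes z b :: complex
  assumes "odd n" "z ^ n = 1" "z \<noteq> 1" "norm b > 1"
  shows "defect n z b = 0"
proof -
  define d where "d = (LEAST i. 0 < i \<and> z ^ i = 1)"
  have n0: "0 < n" using assms(1) by (auto intro: Nat.gr0I)
  have d: "0 < d \<and> z ^ d = 1"
    unfolding d_def by (rule LeastI[of _ n]) (use n0 assms in simp)
  have min: "z ^ i \<noteq> 1" if "0 < i" "i < d" for i
    using that not_less_Least unfolding d_def by blast
  have "z ^ (n mod d) = 1"
  proof -
    have "z ^ n = (z ^ d) ^ (n div d) * z ^ (n mod d)"
      by (simp flip: power_mult power_add)
    then show ?thesis using assms(2) d by simp
  qed
  then have "d dvd n"
    using min[of "n mod d"] d by (auto simp: dvd_eq_mod_eq_0)
  then obtain N where N: "n = N * d" by (metis dvd_def mult.commute)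
  then have "odd d" using assms(1) by simp
  then obtain h where h: "d = 2 * h + 1" using oddE by blast
  have z: "z ^ (2 * h + 1) = 1" using d h by simp
  have prim: "z ^ i \<noteq> 1" if "0 < i" "i < 2 * h + 1" for i
    using min that h by simp
  have N0: "N > 0" using n0 N by auto
  have "c_den z b (n - 1) \<noteq> 0"
    using generic_nonzero[OF z assms(3) prim assms(4)] one_plus_z[OF z assms(3) prim]
    by (simp add: c_den_def c_den_fac_def del: power_Suc)
  moreover have "(\<Sum>k=0..n - 1. \<Sum>j=0..k. c_val z b j * c_val z b (k - j)) = 0"
    using sum_convolution_root[OF z assms(3) prim assms(4) N0] unfolding N h by simp
  moreover have "qint z n = 0"
    using qint_mult_one_minus[of z n] assms by simp
  ultimately show ?thesis by (simp add: defect_eq)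
qed

subsection \<open>Divisibility from vanishing at points\<close>

lemma q_poly_power: "q_poly ^ n = [:monom 1 n:]"
proof (induction n)
  case (Suc n)
  then show ?case by (simp add: q_poly_def monom_altdef)
qed (simp add: one_pCons monom_altdef)

lemma qint_q_poly: "qint q_poly n = [:qint [:0, 1:] n:]"
proof -
  have "comm_ring_hom (\<lambda>p :: rat poly. [:p:])"
    by unfold_locales (simp_all add: one_pCons)
  from comm_ring_hom.hom_qint[OF this, of "[:0, 1:]" n] show ?thesis
    by (simp add: q_poly_def)
qed

lemma eval_q_eq_0:
  fixes p :: "rat poly"
  assumes "\<And>x :: real. x > 1 \<Longrightarrow> eval_q x p = 0"
  shows "p = 0"
proof -
  have "infinite {1<..<2::real}" by (rule infinite_Ioo) simp
  then have "infinite {x. poly (map_poly of_rat p) (x::real) = 0}"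
    by (rule infinite_super[rotated]) (use assms in \<open>auto simp: eval_q_def\<close>)
  then have "map_poly of_rat p = (0 :: real poly)"
    using poly_roots_finite by blast
  then show ?thesis
    by (metis coeff_0 coeff_map_poly of_rat_0 of_rat_eq_0_iff poly_eqI)
qed

text \<open>The divisor is monic in \<open>a\<close>, so the remainder is the value of
  \<open>W\<close> at \<open>a = q^n\<close>, a polynomial in \<open>q\<close> that is zero for all
  real \<open>x > 1\<close>.\<close>

lemma dvd_linear_monic:
  assumes "\<And>x :: real. x > 1 \<Longrightarrow> eval_qa x (x ^ n) W = 0"
  shows "a_poly - q_poly ^ n dvd W"
proof -
  have eq: "a_poly - q_poly ^ n = [:- monom 1 n, 1:]"
    by (simp add: a_poly_def q_poly_power)
  have "poly W (monom 1 n) = 0"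
  proof (rule eval_q_eq_0)
    fix x :: real assume "x > 1"
    interpret comm_ring_hom "eval_qa x (x ^ n)" by (rule eval_qa_hom)
    have "eval_qa x (x ^ n) (a_poly - q_poly ^ n) = 0"
      by (simp add: hom_diff hom_power)
    then show "eval_q x (poly W (monom 1 n)) = 0"
      using arg_cong[OF synthetic_div_correct'[of "monom 1 n" W], of "eval_qa x (x ^ n)"] assms[OF \<open>x > 1\<close>]
      unfolding eq hom_add hom_mult by (simp add: eval_qa_const)
  qed
  then show ?thesis unfolding eq by (simp add: poly_eq_0_iff_dvd)
qed

text \<open>The leading coefficient \<open>- c\<close> is not assumed invertible; division with
  constant remainder becomes possible after multiplication by a power of \<open>c\<close>.\<close>

lemma pseudo_division_reciprocal:
  fixes p :: "'a::comm_ring_1 poly"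
  shows "\<exists>m u r. [:c:] ^ m * p = [:1, - c:] * u + [:r:]"
proof (induction p)
  case 0
  have "[:c:] ^ 0 * 0 = [:1, - c:] * 0 + [:0:]" by simp
  then show ?case by blast
next
  case (pCons b p)
  then obtain m u r where p: "[:c:] ^ m * p = [:1, - c:] * u + [:r:]" by blast
  have "pCons b p = [:b:] + [:0, 1:] * p" by simp
  then have "[:c:] ^ Suc m * pCons b p = [:c:] ^ Suc m * [:b:] + [:0, c:] * ([:c:] ^ m * p)"
    by (simp add: algebra_simps smult_add_right)
  also have "\<dots> = [:c:] ^ Suc m * [:b:] + [:0, c:] * ([:1, - c:] * u) + [:0, c * r:]"
    unfolding p by (simp add: algebra_simps)
  \<comment> \<open>Modulo the divisor, \<open>c\<close> times the variable is 1.\<close>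
  also have "[:0, c * r:] = [:1, - c:] * [:- r:] + [:r:]" by simp
  also have "[:c:] ^ Suc m * [:b:] = [:c ^ Suc m * b:]"
    by (simp add: poly_const_pow mult_ac)
  finally have "[:c:] ^ Suc m * pCons b p
      = [:1, - c:] * ([:0, c:] * u + [:- r:]) + [:r + c ^ Suc m * b:]"
    by (simp add: algebra_simps)
  then show ?case by blast
qed

text \<open>A common divisor has degree 0 in \<open>a\<close>, so it divides every coefficient of
  \<open>f\<close>, including the unit.\<close>

lemma coprime_constI:
  fixes p :: "rat poly" and f :: qa_poly
  assumes "p \<noteq> 0" "is_unit (coeff f i)"
  shows "coprime [:p:] f"
proof (rule coprimeI)
  fix g assume g: "g dvd [:p:]" "g dvd f"
  have "degree g = 0"
    using dvd_imp_degree_le[OF g(1)] assms by simp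
  then obtain c where c: "g = [:c:]" by (rule degree_eq_zeroE)
  then have "c dvd coeff f i" using g(2) by (simp add: const_poly_dvd_iff)
  then have "is_unit c" using assms(2) dvd_unit_imp_unit by blast
  then show "is_unit g" by (simp add: c is_unit_const_poly_iff)
qed

text \<open>Elimination of \<open>a\<close> places every common divisor below a nonzero polynomial
  in \<open>q\<close> alone, and \<open>coprime_constI\<close> finishes.\<close>

lemma coprime_combination:
  fixes f g :: qa_poly
  assumes "u * f + v * g = [:p:]" "p \<noteq> 0" "is_unit (coeff f i)"
  shows "coprime f g"
proof (rule coprimeI)
  fix h assume h: "h dvd f" "h dvd g"
  then have "h dvd [:p:]" unfolding assms(1)[symmetric] by simp
  then show "is_unit h"
    using coprime_constI[OF assms(2,3)] h(1) coprime_common_divisor by blast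
qed

text \<open>Pseudo-division gives divisibility up to a power of \<open>q\<close>, and that power is
  coprime to the divisor, whose constant coefficient in \<open>a\<close> is 1.\<close>

lemma dvd_linear_reciprocal:
  assumes "\<And>x :: real. x > 1 \<Longrightarrow> eval_qa x (inverse (x ^ n)) W = 0"
  shows "1 - a_poly * q_poly ^ n dvd W"
proof -
  have eq: "1 - a_poly * q_poly ^ n = [:1, - monom 1 n:]"
    by (simp add: a_poly_def q_poly_power one_pCons)
  obtain m u r where W: "[:monom 1 n:] ^ m * W = [:1, - monom 1 n:] * u + [:r:]"
    using pseudo_division_reciprocal by blast
  have "r = 0"
  proof (rule eval_q_eq_0)
    fix x :: real assume "x > 1"
    interpret comm_ring_hom "eval_qa x (inverse (x ^ n))" by (rule eval_qa_hom)
    have "eval_qa x (inverse (x ^ n)) (1 - a_poly * q_poly ^ n) = 0"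
      using \<open>x > 1\<close> by (simp add: hom_diff hom_power hom_1 hom_mult)
    then show "eval_q x r = 0"
      using arg_cong[OF W, of "eval_qa x (inverse (x ^ n))"] assms[OF \<open>x > 1\<close>]
      unfolding eq hom_add hom_mult by (simp add: eval_qa_const)
  qed
  then have "[:monom 1 n:] ^ m * W = [:1, - monom 1 n:] * u"
    using W by (simp only: pCons_0_0 add_0_right)
  then have "1 - a_poly * q_poly ^ n dvd [:monom 1 n:] ^ m * W"
    unfolding eq by (rule dvdI)
  moreover have "coprime ([:monom 1 n:] ^ m) (1 - a_poly * q_poly ^ n)"
    unfolding coprime_power_left_iff eq by (intro disjI1 coprime_constI[of _ _ 0]) simp_all
  ultimately show ?thesis
    by (subst (asm) coprime_commute) (simp only: coprime_dvd_mult_right_iff)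
qed

lemma degree_qint: "degree (qint [:0, 1 :: rat:] (Suc n)) = n" "lead_coeff (qint [:0, 1 :: rat:] (Suc n)) = 1"
proof -
  have *: "coeff (qint [:0, 1 :: rat:] m) i = (if i < m then 1 else 0)" for m i
  proof -
    have "[:0, 1 :: rat:] ^ j = monom 1 j" for j by (simp add: monom_altdef)
    then show ?thesis by (simp add: qint_def coeff_sum)
  qed
  show "degree (qint [:0, 1 :: rat:] (Suc n)) = n"
    by (rule antisym) (auto intro!: degree_le le_degree simp: *)
  then show "lead_coeff (qint [:0, 1 :: rat:] (Suc n)) = 1" by (simp add: *)
qed

text \<open>The remainder has degree below \<open>n - 1\<close> but vanishes at all
  \<open>n - 1\<close> nontrivial \<open>n\<close>-th roots of unity, so it is zero. No
  factorization into cyclotomic polynomials enters.\<close>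

lemma qint_dvd:
  fixes p :: "rat poly"
  assumes n: "n > 0" and root: "\<And>z :: complex. z ^ n = 1 \<Longrightarrow> z \<noteq> 1 \<Longrightarrow> eval_q z p = 0"
  shows "qint [:0, 1:] n dvd p"
proof -
  obtain m where m: "n = Suc m" using n gr0_implies_Suc by blast
  define N where "N = qint [:0, 1 :: rat:] n"
  have N: "degree N = m" "N \<noteq> 0" using degree_qint[of m] by (auto simp: N_def m)
  define r where "r = p mod N"
  have "r = 0"
  proof (rule ccontr)
    assume "r \<noteq> 0"
    then have deg: "degree r < m" using degree_mod_less'[of N p] N by (simp add: r_def)
    define R where "R = (map_poly of_rat r :: complex poly)"
    have R0: "R \<noteq> 0"
      using \<open>r \<noteq> 0\<close> unfolding R_def
      by (metis coeff_0 coeff_map_poly of_rat_0 of_rat_eq_0_iff poly_eqI)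
    have "{z :: complex. z ^ n = 1} - {1} \<subseteq> {z. poly R z = 0}"
    proof clarify
      fix z :: complex assume z: "z ^ n = 1" "z \<notin> {}" "z \<noteq> 1"
      interpret comm_ring_hom "eval_q z" by (rule eval_q_hom)
      have "eval_q z N = qint z n"
        unfolding N_def hom_qint by (simp add: eval_q_def map_poly_pCons)
      also have "\<dots> = 0" using qint_mult_one_minus[of z n] z by simp
      finally have "eval_q z (p div N * N + r) = eval_q z r" by (simp add: hom_add hom_mult)
      then show "poly R z = 0" using root[of z] z by (simp add: r_def R_def eval_q_def)
    qed
    then have "card ({z :: complex. z ^ n = 1} - {1}) \<le> card {z. poly R z = 0}"
      using poly_roots_finite[OF R0] by (rule card_mono[rotated])
    also have "\<dots> \<le> degree R" by (rule card_poly_roots_bound[OF R0])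
    also have "\<dots> \<le> degree r" unfolding R_def by (rule map_poly_degree_leq)
    finally show False using deg card_roots_unity_eq[OF n] by (simp add: m)
  qed
  then show ?thesis unfolding r_def N_def by (simp add: dvd_eq_mod_eq_0)
qed

text \<open>The divisor is free of \<open>a\<close>, so divisibility is tested on each coefficient
  of \<open>W\<close>. At fixed \<open>z\<close>, vanishing for infinitely many \<open>b\<close>
  kills all coefficients.\<close>

lemma dvd_qint:
  assumes n: "n > 0"
    and root: "\<And>z b :: complex. z ^ n = 1 \<Longrightarrow> z \<noteq> 1 \<Longrightarrow> norm b > 1 \<Longrightarrow> eval_qa z b W = 0"
  shows "qint q_poly n dvd W"
  unfolding qint_q_poly const_poly_dvd_iff
proof (intro allI qint_dvd[OF n])
  fix i and z :: complex assume z: "z ^ n = 1" "z \<noteq> 1"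
  have "infinite (of_real ` {1<..<2::real} :: complex set)"
    using infinite_Ioo[of 1 "2::real"] by (simp add: finite_image_iff inj_on_def)
  then have "infinite {b. poly (map_poly (eval_q z) W) b = 0}"
    by (rule infinite_super[rotated]) (use root[OF z] in \<open>auto simp: eval_qa_def\<close>)
  then have "map_poly (eval_q z) W = 0"
    using poly_roots_finite by blast
  then show "eval_q z (coeff W i) = 0"
    by (metis coeff_0 coeff_map_poly eval_q_0)
qed

section \<open>Coprimality of the factors of the modulus and of the denominators\<close>

definition modulus :: "nat \<Rightarrow> qa_poly" where
  "modulus n = qint q_poly n * (1 - a_poly * q_poly ^ n) * (a_poly - q_poly ^ n)"

lemma linear_reciprocal_eq: "1 - a_poly * q_poly ^ i = [:1, - monom 1 i:]"
  by (simp add: a_poly_def q_poly_power one_pCons)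

lemma linear_monic_eq: "a_poly - q_poly ^ i = [:- monom 1 i, 1:]"
  by (simp add: a_poly_def q_poly_power)

lemma one_plus_q_poly: "1 + q_poly ^ i = [:1 + monom 1 i:]"
  by (simp add: q_poly_power one_pCons)

lemma monom_1_eq_iff: "monom (1::rat) i = monom 1 j \<longleftrightarrow> i = j"
  by (metis degree_monom_eq one_neq_zero)

lemma coprime_linear:
  assumes "i \<noteq> j"
  shows "coprime (1 - a_poly * q_poly ^ i) (1 - a_poly * q_poly ^ j)"
    and "coprime (a_poly - q_poly ^ i) (a_poly - q_poly ^ j)"
proof -
  have "[:monom 1 j:] * (1 - a_poly * q_poly ^ i) + (- [:monom 1 i:]) * (1 - a_poly * q_poly ^ j)
      = [:monom 1 j - monom 1 i:]"
    by (simp add: linear_reciprocal_eq mult.commute)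
  then show "coprime (1 - a_poly * q_poly ^ i) (1 - a_poly * q_poly ^ j)"
    by (rule coprime_combination[where i = 0]) (use assms in \<open>simp_all add: linear_reciprocal_eq monom_1_eq_iff\<close>)
  have "1 * (a_poly - q_poly ^ i) + (- 1) * (a_poly - q_poly ^ j) = [:monom 1 j - monom 1 i:]"
    by (simp add: linear_monic_eq)
  then show "coprime (a_poly - q_poly ^ i) (a_poly - q_poly ^ j)"
    by (rule coprime_combination[where i = 1]) (use assms in \<open>simp_all add: linear_monic_eq monom_1_eq_iff\<close>)
qed

text \<open>Elimination of \<open>a\<close> leaves \<open>1 - q^(i+j)\<close>. The case
  \<open>i = j = n\<close> separates the two linear factors of the modulus.\<close>

lemma coprime_linear_mixed:
  assumes "i + j > 0"
  shows "coprime (1 - a_poly * q_poly ^ i) (a_poly - q_poly ^ j)"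
proof -
  have "1 * (1 - a_poly * q_poly ^ i) + [:monom 1 i:] * (a_poly - q_poly ^ j)
      = [:monom 1 0 - monom 1 (i + j):]"
    by (simp add: linear_reciprocal_eq linear_monic_eq mult_monom add.commute)
  then show ?thesis
    by (rule coprime_combination[where i = 0])
      (use assms monom_1_eq_iff[of 0 "i + j"] in \<open>auto simp: linear_reciprocal_eq\<close>)
qed

lemma coprime_const_linear:
  assumes "p \<noteq> 0"
  shows "coprime [:p:] (1 - a_poly * q_poly ^ i)" "coprime [:p:] (a_poly - q_poly ^ i)"
  by (rule coprime_constI[OF assms, of _ 0], simp add: linear_reciprocal_eq)
     (rule coprime_constI[OF assms, of _ 1], simp add: linear_monic_eq)

text \<open>A common divisor divides both \<open>1 - q^(n i)\<close> and, as \<open>n\<close> is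
  odd, \<open>1 + q^(n i)\<close>; hence it divides 2, a unit over the rationals.\<close>

lemma coprime_one_plus_qint:
  assumes "odd n"
  shows "coprime (1 + q_poly ^ i) (qint q_poly n)"
proof (rule coprimeI)
  fix g assume g: "g dvd 1 + q_poly ^ i" "g dvd qint q_poly n"
  have "g dvd 1 - q_poly ^ n"
    unfolding qint_mult_one_minus[symmetric] using g(2) by simp
  moreover have "1 - q_poly ^ n dvd 1 - (q_poly ^ n) ^ i"
    unfolding one_diff_power_eq by simp
  ultimately have "g dvd 1 - (q_poly ^ n) ^ i" by (rule dvd_trans)
  moreover have "1 - (- (q_poly ^ i)) dvd 1 - (- (q_poly ^ i)) ^ n"
    unfolding one_diff_power_eq by simp
  then have "g dvd 1 + (q_poly ^ i) ^ n"
    using g(1) assms by (simp add: power_minus_odd) (erule (1) dvd_trans)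
  ultimately have "g dvd (1 - (q_poly ^ n) ^ i) + (1 + (q_poly ^ i) ^ n)" by (rule dvd_add)
  also have "(1 - (q_poly ^ n) ^ i) + (1 + (q_poly ^ i) ^ n) = 2"
    by (simp add: mult.commute flip: power_mult)
  finally have "g dvd 2" .
  moreover have "(2 :: qa_poly) * [:[:1/2:]:] = 1"
    by (simp add: numeral_poly one_pCons)
  then have "is_unit (2 :: qa_poly)" by (metis dvd_triv_left)
  ultimately show "is_unit g" using dvd_unit_imp_unit by blast
qed

lemma one_plus_monom_nonzero: "1 + monom (1::rat) (Suc i) \<noteq> 0"
proof
  assume "1 + monom (1::rat) (Suc i) = 0"
  then have "coeff (1 + monom (1::rat) (Suc i)) 0 = 0" by simp
  then show False by simp
qed

lemma qint_nonzero: "n > 0 \<Longrightarrow> qint [:0, 1 :: rat:] n \<noteq> 0"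
  using degree_qint(2)[of "n - 1"] by (cases n) auto

text \<open>The exponents in the denominator stay below \<open>n\<close>, so none of its linear
  factors coincides with one of the modulus.\<close>

lemma coprime_c_den_modulus:
  assumes "odd n"
  shows "coprime (c_den q_poly a_poly (n - 1)) (modulus n)"
  unfolding c_den_def
proof (rule prod_coprime_left)
  fix i assume "i \<in> {..<n - 1}"
  then have i: "Suc i \<noteq> n" by simp
  have n0: "n > 0" using assms by (auto intro: Nat.gr0I)
  note cp = coprime_linear[OF i] coprime_linear_mixed[of "Suc i" n] coprime_linear_mixed[of n "Suc i"]
     coprime_const_linear[OF qint_nonzero[OF n0]] coprime_const_linear[OF one_plus_monom_nonzero[of i]]
     coprime_one_plus_qint[OF assms, of "Suc i"]
  then show "coprime (c_den_fac q_poly a_poly i) (modulus n)"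
    using n0 unfolding c_den_fac_def modulus_def coprime_mult_left_iff coprime_mult_right_iff
    by (simp add: qint_q_poly one_plus_q_poly coprime_commute del: power_Suc mult_pCons_left)
qed

lemma modulus_dvd:
  assumes "odd n"
    and "\<And>x :: real. x > 1 \<Longrightarrow> eval_qa x (x ^ n) W = 0"
    and "\<And>x :: real. x > 1 \<Longrightarrow> eval_qa x (inverse (x ^ n)) W = 0"
    and "\<And>z b :: complex. z ^ n = 1 \<Longrightarrow> z \<noteq> 1 \<Longrightarrow> norm b > 1 \<Longrightarrow> eval_qa z b W = 0"
  shows "modulus n dvd W"
proof -
  have n0: "n > 0" using assms(1) by (auto intro: Nat.gr0I)
  note cp = coprime_const_linear[OF qint_nonzero[OF n0]] coprime_linear_mixed[of n n]
  show ?thesis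
    unfolding modulus_def using n0 cp assms
    by (intro divides_mult dvd_qint dvd_linear_monic dvd_linear_reciprocal)
       (auto simp: qint_q_poly coprime_mult_left_iff simp del: mult_pCons_left)
qed

section \<open>Return to the rational functions and conclusion\<close>

lemma c_val_qpochs:
  fixes q a :: "'a::field"
  assumes "a \<noteq> 0" and nz: "\<And>i. 1 - q ^ Suc i \<noteq> 0" "\<And>i. 1 + q ^ Suc i \<noteq> 0"
  shows "(- 1) ^ k * qint q (3 * k + 1)
     * (qpochs [a * q, q / a, q] (q\<^sup>2) k / qpochs [a * q, q / a, q] q k) = c_val q a k"
proof -
  have "qpoch (a * q) (q\<^sup>2) k * qpoch (q / a) (q\<^sup>2) k / (qpoch (a * q) q k * qpoch (q / a) q k)
     = param_part q a k"
  proof -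
    have e: "1 - q / a * x = (a - q * x) / a" for x
      using assms(1) by (simp add: field_simps)
    show ?thesis
      unfolding qpoch_def param_part_def e prod.distrib[symmetric] prod_dividef[symmetric]
      using assms(1) by (intro prod.cong refl) (simp add: mult_ac flip: power_mult)
  qed
  moreover have "qpoch q (q\<^sup>2) k / qpoch q q k = central_gbinom q k / (\<Prod>i<k. 1 + q ^ Suc i)"
  proof -
    have "qpoch q q k \<noteq> 0" "(\<Prod>i<k. 1 + q ^ Suc i) \<noteq> 0"
      using nz by (simp_all add: qpoch_def)
    then show ?thesis
      using central_gbinom_qpoch[of q k] by (simp add: qpoch_def frac_eq_eq power_mult)
  qed
  moreover have "qpochs [a * q, q / a, q] (q\<^sup>2) k / qpochs [a * q, q / a, q] q k
     = (qpoch (a * q) (q\<^sup>2) k * qpoch (q / a) (q\<^sup>2) k / (qpoch (a * q) q k * qpoch (q / a) q k))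
       * (qpoch q (q\<^sup>2) k / qpoch q q k)"
    by (simp add: qpochs_def mult.assoc)
  ultimately have e: "qpochs [a * q, q / a, q] (q\<^sup>2) k / qpochs [a * q, q / a, q] q k
     = param_part q a k * (central_gbinom q k / (\<Prod>i<k. 1 + q ^ Suc i))"
    by simp
  show ?thesis
    unfolding e c_val_def const_part_def by simp
qed

lemma c_q_eq: "c_q k = c_val q_rat a_rat k"
proof -
  interpret fr: comm_ring_hom "to_fract :: qa_poly \<Rightarrow> qa_ratfun" by (rule to_fract_hom)
  have f1: "1 - q_poly ^ Suc i \<noteq> 0" for i
  proof -
    have "1 - q_poly ^ Suc i = [:monom 1 0 - monom 1 (Suc i):]"
      by (simp add: q_poly_power one_pCons del: power_Suc)
    then show ?thesis using monom_1_eq_iff[of 0 "Suc i"] by (simp del: power_Suc)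
  qed
  have f2: "1 + q_poly ^ Suc i \<noteq> 0" for i
    unfolding one_plus_q_poly using one_plus_monom_nonzero[of i] by simp
  have e: "1 - q_rat ^ i = to_fract (1 - q_poly ^ i)" "1 + q_rat ^ i = to_fract (1 + q_poly ^ i)" for i
    by (simp_all add: q_rat_def fr.homs)
  show ?thesis
    unfolding c_q_def
  proof (rule c_val_qpochs)
    show "a_rat \<noteq> 0" by (simp add: a_rat_def a_poly_def)
    show "1 - q_rat ^ Suc i \<noteq> 0" for i
      unfolding e to_fract_eq_0_iff by (rule f1)
    show "1 + q_rat ^ Suc i \<noteq> 0" for i
      unfolding e to_fract_eq_0_iff by (rule f2)
  qed
qed

lemma c_den_nonzero: "c_den q_poly a_poly k \<noteq> 0"
proof -
  have "c_den_fac q_poly a_poly i \<noteq> 0" for i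
    unfolding c_den_fac_def one_plus_q_poly linear_reciprocal_eq linear_monic_eq mult_eq_0_iff
    using one_plus_monom_nonzero[of i] by simp
  then show ?thesis by (simp add: c_den_def)
qed

theorem theorem2p4:
  fixes n :: nat
  assumes "odd n"
  shows "ratfun_cong
           (\<Sum>k=0..n-1. \<Sum>j=0..k. c_q j * c_q (k - j))
           (q_rat ^ ((n - 1) ^ 2 div 2) * qint q_rat n ^ 2)
           (qint q_poly n * (1 - a_poly * q_poly ^ n) * (a_poly - q_poly ^ n))"
proof -
  interpret fr: comm_ring_hom "to_fract :: qa_poly \<Rightarrow> qa_ratfun" by (rule to_fract_hom)
  define D where "D = c_den q_poly a_poly (n - 1)"
  define E where "E = (\<Sum>k=0..n-1. \<Sum>j=0..k. c_q j * c_q (k - j))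
       - q_rat ^ ((n - 1)\<^sup>2 div 2) * (qint q_rat n)\<^sup>2"
  define W where "W = defect n q_poly a_poly"
  have cop: "coprime D (modulus n)" unfolding D_def by (rule coprime_c_den_modulus[OF assms])
  have D0: "D \<noteq> 0" unfolding D_def by (rule c_den_nonzero)
  have "modulus n dvd W"
  proof (rule modulus_dvd[OF assms])
    show "eval_qa x (x ^ n) W = 0" "eval_qa x (inverse (x ^ n)) W = 0" if "x > 1" for x :: real
      unfolding W_def comm_ring_hom.hom_defect[OF eval_qa_hom] eval_qa_gens
      using defect_inverse_power[OF assms that] by blast+
    show "eval_qa z b W = 0" if "z ^ n = 1" "z \<noteq> 1" "norm b > 1" for z b :: complex
      unfolding W_def comm_ring_hom.hom_defect[OF eval_qa_hom] eval_qa_gens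
      using defect_root_of_unity[OF assms that] .
  qed
  then obtain U where U: "W = modulus n * U" by blast
  have Dr: "c_den q_rat a_rat (n - 1) = to_fract D"
    unfolding D_def q_rat_def a_rat_def fr.hom_c_den ..
  have "to_fract (modulus n) * to_fract U = to_fract W"
    by (simp add: U)
  also have "\<dots> = (to_fract D)\<^sup>2 * ((\<Sum>k=0..n-1. \<Sum>j=0..k. c_q j * c_q (k - j))
       - q_rat ^ ((n - 1)\<^sup>2 div 2) * (qint q_rat n)\<^sup>2)"
    unfolding W_def fr.hom_defect q_rat_def[symmetric] a_rat_def[symmetric] c_q_eq Dr[symmetric]
    by (rule defect_eq) (simp only: Dr to_fract_eq_0_iff D0 not_False_eq_True)
  also have "(to_fract D)\<^sup>2 = to_fract (D\<^sup>2)"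
    by (rule fr.hom_power[symmetric])
  finally have prod: "to_fract (modulus n) * to_fract U = to_fract (D\<^sup>2) * E"
    unfolding E_def .
  \<comment> \<open>The denominator \<open>V\<close> in the congruence is \<open>D\<^sup>2\<close>,
    one factor \<open>D\<close> for each of the two terms in a product.\<close>
  have "E = to_fract (modulus n) * (to_fract U / to_fract (D\<^sup>2))"
    unfolding times_divide_eq_right prod using D0 by simp
  moreover have "D\<^sup>2 \<noteq> 0" "coprime (D\<^sup>2) (modulus n)" using D0 cop by simp_all
  ultimately show ?thesis
    unfolding ratfun_cong_def E_def modulus_def by blast
qed

end
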